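(* Let $G=(V,E)$ be an infinite, connected, undirected, locally finite unimodular graph, and let $\mathcal{A}$ be any relevant event. Let $(\lambda,\mu)\in\mathbb{R}_+^2$, where $\mathbb{R}_+=(0,\infty)$, and let $$\mathcal{C}_{\lambda,\mu}:=\Big\{(x,y)\in\mathbb{R}^2\ :\ y\ge \frac{1}{\lambda(1+\lambda)}(x-\lambda)+\mu,\ \ x\ge\lambda\Big\}.$$ Then, for any pair $(\lambda',\mu')\in\mathcal{C}_{\lambda,\mu}$, $$\mathcal{P}_{\lambda,\mu}(\mathcal{A})\le \mathcal{P}_{\lambda',\mu'}(\mathcal{A}).$$
   Context: A graph is unimodular if its automorphism group is unimodular, i.e. $|\mathrm{Stab}(x)\,y|=|\mathrm{Stab}(y)\,x|$ for all vertices $x,y$ in the same orbit of the automorphism group. Diaconis-Fulton representation of activated random walk. $\mathbb{N}=\{1,2,\dots\}$, $\mathbb{N}_0=\{0,1,2,\dots\}$; $d_x$ is the degree of $x$, and $x\sim y$ means $\{x,y\}\in E$. The set of particle configurations is $\mathcal{H}=\{0,\rho,1,2,3,\dots\}^V$, where state $\rho$ means one sleeping particle and state $i\in\mathbb{N}_0$ means $i$ active particles. A vertex $x$ is unstable in $\eta\in\mathcal{H}$ if $\eta(x)\in\mathbb{N}$, and stable if $\eta(x)\in\{0,\rho\}$. An array of instructions is $\tau=(\tau^{x,j})_{x\in V,j\in\mathbb{N}_0}$ with $\tau^{x,j}\in\{\tau_{x\rho}\}\cup\{\tau_{xy}:y\sim x\}$; $\mathcal{I}$ is the set of arrays. The jump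 instruction $\tau_{xy}$ and the sleep instruction $\tau_{x\rho}$ are operators that may be applied only to configurations in which $x$ is unstable (they are then called legal): $\tau_{xy}$ changes $\eta(x)$ to $\eta(x)-1$ and $\eta(y)$ to $\eta(y)+1$, with the convention $\rho+1=2$; $\tau_{x\rho}$ changes $\eta(x)$ to $\rho$ if $\eta(x)=1$, and leaves $\eta$ unchanged if $\eta(x)\ge2$. A finite sequence $\alpha=((x_1,n_1),\dots,(x_k,n_k))$ in $V\times\mathbb{N}_0$ is a legal sequence for $\eta$ (with array $\tau$) if, for each vertex $x$, the successive entries of $\alpha$ with first coordinate $x$ have second coordinates $0,1,2,\dots$ in this order, and for each $i$ the instruction $\tau^{x_i,n_i}$ is legal for $\tau^{x_{i-1},n_{i-1}}\cdots\tau^{x_1,n_1}\eta$. It is contained in $K\subset V$ if all $x_i\in K$. Let $M_{\alpha,\tau}(x)$ be the number of $i$ with $x_i=x$ and $\tau^{x_i,n_i}\ne\tau_{x\rho}$ (number of jump instructions used at $x$). The jump odometer is $M_{K,\eta,\tau}(x)=\sup_\alpha M_{\alpha,\tau}(x)$, the supremum being over legal sequences for $\eta$ contained in $K$. An event $\mathcal{A}\subset\mathcal{H}\times\mathcal{I}$ (measurable for the Borel $\sigma$-algebra of the product topology) is relevant if there are a finite set $K\subset V$ and a function $H\in\mathbb{N}_0^K$ with $\mathcal{A}=\{(\eta,\tau):M_{K,\eta,\tau}(x)\ge H(x)\ \forall x\in K\}$. $\mathcal{P}_{\lambda,\mu}$ is the probability measure on $\mathcal{H}\times\mathcal{I}$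 under which $\eta$ and $\tau$ are independent, the $\eta(x)$, $x\in V$, are i.i.d. Poisson with mean $\mu$ (all particles active), and the $\tau^{x,j}$ are independent with $\tau^{x,j}=\tau_{x\rho}$ with probability $\frac{\lambda}{1+\lambda}$ and $\tau^{x,j}=\tau_{xy}$ with probability $\frac{1}{d_x(1+\lambda)}$ for each $y\sim x$. *)

theory Defs
  imports "HOL-Probability.Probability" "HOL-Library.Extended_Nat"
begin

text \<open>
  A graph is given by its edge set \<open>E\<close>; the vertex set is the whole type \<open>'v\<close>.
\<close>

definition undirected_graph :: "'v set set \<Rightarrow> bool" where
  "undirected_graph E \<longleftrightarrow> (\<forall>e\<in>E. card e = 2)"

definition adj :: "'v set set \<Rightarrow> 'v \<Rightarrow> 'v \<Rightarrow> bool" where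
  "adj E x y \<longleftrightarrow> {x, y} \<in> E"

definition nbrs :: "'v set set \<Rightarrow> 'v \<Rightarrow> 'v set" where
  "nbrs E x = {y. adj E x y}"

definition vdegree :: "'v set set \<Rightarrow> 'v \<Rightarrow> nat" where
  "vdegree E x = card (nbrs E x)"

definition locally_finite :: "'v set set \<Rightarrow> bool" where
  "locally_finite E \<longleftrightarrow> (\<forall>x. finite (nbrs E x))"

definition connected_graph :: "'v set set \<Rightarrow> bool" where
  "connected_graph E \<longleftrightarrow> (\<forall>x y. (adj E)\<^sup>*\<^sup>* x y)"

definition graph_aut :: "'v set set \<Rightarrow> ('v \<Rightarrow> 'v) set" where
  "graph_aut E = {f. bij f \<and> (\<forall>x y. adj E (f x) (f y) \<longleftrightarrow> adj E x y)}"

definition graph_stab :: "'v set set \<Rightarrow> 'v \<Rightarrow> ('v \<Rightarrow> 'v) set" where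
  "graph_stab E x = {f \<in> graph_aut E. f x = x}"

text \<open>
  In a connected locally finite graph every set \<open>Stab(x) y\<close> lies in a sphere around \<open>x\<close> and is
  therefore finite, so that \<open>card\<close> is the genuine cardinality.
\<close>

definition unimodular :: "'v set set \<Rightarrow> bool" where
  "unimodular E \<longleftrightarrow>
     (\<forall>x y. (\<exists>f\<in>graph_aut E. f x = y) \<longrightarrow>
        card ((\<lambda>f. f y) ` graph_stab E x) = card ((\<lambda>f. f x) ` graph_stab E y))"


text \<open>
  \<open>Active i\<close> is the state \<open>i\<close> (so \<open>Active 0\<close> is the empty site) and \<open>Sleeping\<close> is the state \<open>\<rho>\<close>.
  The instructions \<open>Sleep\<close> and \<open>Jump y\<close> stand for \<open>\<tau>\<^sub>x\<^sub>\<rho>\<close> and \<open>\<tau>\<^sub>x\<^sub>y\<close>; the vertex \<open>x\<close> is not part of the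
  instruction, being determined by its position \<open>(x, j)\<close> in the array.
\<close>

datatype site = Active nat | Sleeping

datatype 'v instr = Sleep | Jump 'v

type_synonym 'v config = "'v \<Rightarrow> site"
type_synonym 'v array = "'v \<times> nat \<Rightarrow> 'v instr"

definition unstable :: "'v config \<Rightarrow> 'v \<Rightarrow> bool" where
  "unstable \<eta> x \<longleftrightarrow> (\<exists>n\<ge>1. \<eta> x = Active n)"

definition instrs_at :: "'v set set \<Rightarrow> 'v \<Rightarrow> 'v instr set" where
  "instrs_at E x = insert Sleep (Jump ` nbrs E x)"

definition arrays :: "'v set set \<Rightarrow> 'v array set" where
  "arrays E = {\<tau>. \<forall>x j. \<tau> (x, j) \<in> instrs_at E x}"

fun remove_particle :: "site \<Rightarrow> site" where
  "remove_particle (Active n) = Active (n - 1)"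
| "remove_particle Sleeping = Sleeping"

fun add_particle :: "site \<Rightarrow> site" where
  "add_particle (Active n) = Active (n + 1)"
| "add_particle Sleeping = Active 2"

text \<open>
  The instruction \<open>i\<close> performed at \<open>x\<close>. This is meaningful only when \<open>x\<close> is unstable; elsewhere the
  value is junk, and it is excluded by \<open>legal_seq\<close> below.
\<close>

fun apply_instr :: "'v \<Rightarrow> 'v instr \<Rightarrow> 'v config \<Rightarrow> 'v config" where
  "apply_instr x Sleep \<eta> = (if \<eta> x = Active 1 then \<eta>(x := Sleeping) else \<eta>)"
| "apply_instr x (Jump y) \<eta> =
     (let \<eta>' = \<eta>(x := remove_particle (\<eta> x)) in \<eta>'(y := add_particle (\<eta>' y)))"

primrec apply_seq :: "'v array \<Rightarrow> ('v \<times> nat) list \<Rightarrow> 'v config \<Rightarrow> 'v config" where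
  "apply_seq \<tau> [] \<eta> = \<eta>"
| "apply_seq \<tau> (p # \<alpha>) \<eta> = apply_seq \<tau> \<alpha> (apply_instr (fst p) (\<tau> p) \<eta>)"

definition legal_seq :: "'v config \<Rightarrow> 'v array \<Rightarrow> ('v \<times> nat) list \<Rightarrow> bool" where
  "legal_seq \<eta> \<tau> \<alpha> \<longleftrightarrow>
     (\<forall>x. let ns = map snd (filter (\<lambda>p. fst p = x) \<alpha>) in ns = [0..<length ns]) \<and>
     (\<forall>i<length \<alpha>. unstable (apply_seq \<tau> (take i \<alpha>) \<eta>) (fst (\<alpha> ! i)))"

definition jump_count :: "'v array \<Rightarrow> ('v \<times> nat) list \<Rightarrow> 'v \<Rightarrow> nat" where
  "jump_count \<tau> \<alpha> x = length (filter (\<lambda>p. fst p = x \<and> \<tau> p \<noteq> Sleep) \<alpha>)"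

definition jump_odometer :: "'v set \<Rightarrow> 'v config \<Rightarrow> 'v array \<Rightarrow> 'v \<Rightarrow> enat" where
  "jump_odometer K \<eta> \<tau> x =
     (SUP \<alpha>\<in>{\<alpha>. legal_seq \<eta> \<tau> \<alpha> \<and> fst ` set \<alpha> \<subseteq> K}. enat (jump_count \<tau> \<alpha> x))"


text \<open>
  The vertex set of a connected locally finite graph is countable and the coordinate spaces are
  discrete and countable, so the product \<open>\<sigma>\<close>-algebra below is the Borel \<open>\<sigma>\<close>-algebra of the product
  topology. Arrays range over all functions here; \<open>relevant_event\<close> restricts them to \<open>arrays E\<close>,
  which is a measurable set of full measure under \<open>arw_measure\<close>.
\<close>

definition arw_space :: "('v config \<times> 'v array) measure" where
  "arw_space = (\<Pi>\<^sub>M x\<in>UNIV. count_space UNIV) \<Otimes>\<^sub>M (\<Pi>\<^sub>M p\<in>UNIV. count_space UNIV)"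

definition relevant_event :: "'v set set \<Rightarrow> ('v config \<times> 'v array) set \<Rightarrow> bool" where
  "relevant_event E A \<longleftrightarrow>
     A \<in> sets arw_space \<and>
     (\<exists>K (H :: 'v \<Rightarrow> nat). finite K \<and>
        A = {(\<eta>, \<tau>). \<tau> \<in> arrays E \<and> (\<forall>x\<in>K. jump_odometer K \<eta> \<tau> x \<ge> enat (H x))})"

text \<open>
  The sleep rate is \<open>l\<close>: a sleep instruction is drawn with probability \<open>l / (1 + l)\<close>, and otherwise
  a jump to a uniformly chosen neighbour; see the two \<open>pmf\<close> lemmas.
\<close>

definition instr_pmf :: "'v set set \<Rightarrow> real \<Rightarrow> 'v \<Rightarrow> 'v instr pmf" where
  "instr_pmf E l x =
     bernoulli_pmf (l / (1 + l)) \<bind>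
       (\<lambda>b. if b then return_pmf Sleep else map_pmf Jump (pmf_of_set (nbrs E x)))"

lemma pmf_instr_Sleep:
  assumes "l > 0"
  shows "pmf (instr_pmf E l x) Sleep = l / (1 + l)"
proof -
  have "pmf (map_pmf Jump (pmf_of_set (nbrs E x))) Sleep = 0"
    by (auto simp: pmf_eq_0_set_pmf)
  with assms show ?thesis
    by (simp add: instr_pmf_def pmf_bind field_simps)
qed

lemma pmf_instr_Jump:
  assumes "l > 0" "finite (nbrs E x)" "nbrs E x \<noteq> {}"
  shows "pmf (instr_pmf E l x) (Jump y) =
           (if adj E x y then 1 / (real (vdegree E x) * (1 + l)) else 0)"
proof -
  have "pmf (map_pmf Jump (pmf_of_set (nbrs E x))) (Jump y) = pmf (pmf_of_set (nbrs E x)) y"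
    by (rule pmf_map_inj') (simp add: inj_on_def)
  moreover have "1 - l / (1 + l) = 1 / (1 + l)"
    using assms by (simp add: field_simps)
  ultimately show ?thesis
    using assms by (simp add: instr_pmf_def pmf_bind vdegree_def nbrs_def indicator_def)
qed

definition arw_measure :: "'v set set \<Rightarrow> real \<Rightarrow> real \<Rightarrow> ('v config \<times> 'v array) measure" where
  "arw_measure E l m =
     (\<Pi>\<^sub>M x\<in>UNIV. measure_pmf (map_pmf Active (poisson_pmf m))) \<Otimes>\<^sub>M
     (\<Pi>\<^sub>M p\<in>UNIV. measure_pmf (instr_pmf E l (fst p)))"

definition param_region :: "real \<Rightarrow> real \<Rightarrow> (real \<times> real) set" where
  "param_region l m = {(x, y). y \<ge> 1 / (l * (1 + l)) * (x - l) + m \<and> x \<ge> l}"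

end

theory Submission
  imports Defs
begin

text \<open>
  Cut the instruction stack of a vertex into blocks, each a possibly empty run of sleep instructions
  followed by one jump. For counting jumps it only matters whether the run is empty: with two or
  more particles present sleep instructions do nothing, and with exactly one particle the first of
  them blocks the vertex until another particle arrives, after which the remaining ones do nothing.
  So the odometer is governed by jumps alone: with \<open>k\<close> jumps made, \<open>x\<close> can jump again iff it holds at
  least one particle, or at least two when block \<open>k\<close> contains a sleep instruction. These dynamics
  are monotone, hence have the exchange property of an abelian network, and a relevant event says
  that some reachable vector of jump counts dominates \<open>H\<close> (lemma \<open>jump_odometer_iff_reachable\<close>). For
  an independent stack the sleep marks of the blocks are independent with probability
  \<open>p = \<lambda> / (1 + \<lambda>)\<close>, and are independent of the jump targets, whose law does not involve \<open>\<lambda>\<close>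
  (lemma \<open>emeasure_blocks\<close>).

  Now freeze everything except the initial number \<open>n\<close> of particles and the set \<open>B\<close> of sleep marks at
  one vertex \<open>x\<close>. If the event holds with \<open>n\<close> particles and no marks, then it holds with \<open>n + 1\<close>
  particles and arbitrary marks, because the extra particle keeps \<open>x\<close> awake. If it holds for two
  sets of marks, then it holds for their union: a maximal run under the union could be stuck only at
  \<open>x\<close>, on a mark that would have to be absent from both sets. Consequently there are a number \<open>n\<^sub>0\<close> and a set \<open>S\<close>
  such that the event is \<open>n > n\<^sub>0 \<or> (n = n\<^sub>0 \<and> B \<inter> S = {})\<close>, unless it is impossible. With \<open>j\<close> the number of
  elements of \<open>S\<close> that matter, its probability is
  \<open>P(n > n\<^sub>0) + P(n = n\<^sub>0) (1 + \<lambda>)\<^sup>-\<^sup>j\<close>, where \<open>n\<close> is Poisson with mean \<open>\<mu>\<close>. Write \<open>q = P(n = n\<^sub>0)\<close> and \<open>w = (1 + \<lambda>)\<^sup>-\<^sup>j\<close>.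
  The derivative in \<open>\<mu>\<close> is at least \<open>q (1 - w)\<close> and the derivative in \<open>\<lambda>\<close> is \<open>- q j w / (1 + \<lambda>)\<close>.
  Bernoulli's inequality \<open>1 + j \<lambda> \<le> (1 + \<lambda>)\<^sup>j\<close> gives \<open>j w / (1 + \<lambda>) \<le> (1 - w) / (\<lambda> (1 + \<lambda>))\<close>, so raising \<open>\<mu>\<close>
  at \<open>1 / (\<lambda> (1 + \<lambda>))\<close> times the speed of \<open>\<lambda>\<close> compensates the loss; this slope
  only decreases as \<open>\<lambda>\<close> grows, so the bound holds along the whole segment from \<open>(\<lambda>, \<mu>)\<close> to \<open>(\<lambda>', \<mu>')\<close>
  (lemma \<open>threshold_prob_mono\<close>).

  Finally let the parameters depend on the vertex. Changing them at a single vertex amounts to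
  resampling that vertex independently of the rest, so the one-vertex inequality integrates to the
  whole field. Changing the vertices of the finite set \<open>K\<close> one at a time, and then those outside
  \<open>K\<close>, which do not influence the event, proves the theorem.
\<close>

section \<open>The jump-only dynamics\<close>

text \<open>
  Only \<open>K\<close> contributes, since only vertices of \<open>K\<close> are allowed to jump; \<open>J y k\<close> is the target of
  the \<open>k\<close>-th jump of \<open>y\<close>.
\<close>

definition arrivals :: "'v set \<Rightarrow> ('v \<Rightarrow> nat \<Rightarrow> 'v) \<Rightarrow> ('v \<Rightarrow> nat) \<Rightarrow> 'v \<Rightarrow> nat" where
  "arrivals K J u x = (\<Sum>y\<in>K. card {k. k < u y \<and> J y k = x})"

text \<open>
  Here \<open>Z x\<close> is the set of those \<open>k\<close> for which a sleep instruction precedes the \<open>k\<close>-th jump of \<open>x\<close>,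
  and \<open>c x + arrivals K J u x - u x\<close> is the number of particles at \<open>x\<close>; the condition is written
  without subtraction.
\<close>

definition can_jump ::
  "'v set \<Rightarrow> ('v \<Rightarrow> nat) \<Rightarrow> ('v \<Rightarrow> nat \<Rightarrow> 'v) \<Rightarrow> ('v \<Rightarrow> nat set) \<Rightarrow> ('v \<Rightarrow> nat) \<Rightarrow> 'v \<Rightarrow> bool" where
  "can_jump K c J Z u x \<longleftrightarrow> u x + 1 + of_bool (u x \<in> Z x) \<le> c x + arrivals K J u x"

inductive reachable ::
  "'v set \<Rightarrow> ('v \<Rightarrow> nat) \<Rightarrow> ('v \<Rightarrow> nat \<Rightarrow> 'v) \<Rightarrow> ('v \<Rightarrow> nat set) \<Rightarrow> ('v \<Rightarrow> nat) \<Rightarrow> bool"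
  for K c J Z where
    zero: "reachable K c J Z (\<lambda>_. 0)"
  | jump: "reachable K c J Z u \<Longrightarrow> x \<in> K \<Longrightarrow> can_jump K c J Z u x \<Longrightarrow>
           reachable K c J Z (u(x := Suc (u x)))"

lemma arrivals_mono: "u \<le> v \<Longrightarrow> arrivals K J u x \<le> arrivals K J v x"
  unfolding arrivals_def
  by (intro sum_mono card_mono) (auto simp: le_fun_def intro: less_le_trans)

lemma can_jump_mono:
  "can_jump K c J Z u x \<Longrightarrow> u \<le> v \<Longrightarrow> u x = v x \<Longrightarrow> can_jump K c J Z v x"
  using arrivals_mono[of u v K J x] by (simp add: can_jump_def)

text \<open>
  Along a run to \<open>v\<close>, consider the first step that leaves the region below \<open>u\<close>. Its vertex has made
  as many jumps as under \<open>u\<close>, while all others have made at most as many, so by monotonicity the step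
  is also possible at \<open>u\<close>.
\<close>

lemma reachable_exchange:
  assumes "reachable K c J Z v" "\<not> v \<le> u"
  shows "\<exists>y\<in>K. u y < v y \<and> can_jump K c J Z u y"
proof -
  have "v \<le> u \<or> (\<exists>y\<in>K. u y < v y \<and> can_jump K c J Z u y)"
    using assms(1)
  proof (induction rule: reachable.induct)
    case zero
    then show ?case by (simp add: le_fun_def)
  next
    case (jump v x)
    show ?case
    proof (cases "v \<le> u")
      case True
      then have "v x \<le> u x" by (simp add: le_fun_def)
      then consider "v x < u x" | "v x = u x" by linarith
      then show ?thesis
      proof cases
        case 1
        with True have "v(x := Suc (v x)) \<le> u" by (auto simp: le_fun_def)
        then show ?thesis ..
      next
        case 2
        with True jump.hyps can_jump_mono[of K c J Z v x u] show ?thesis by auto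
      qed
    next
      case False
      then obtain y where "y \<in> K" "u y < v y" "can_jump K c J Z u y" using jump.IH by blast
      then show ?thesis by (intro disjI2 bexI[of _ y]) auto
    qed
  qed
  then show ?thesis using assms(2) by blast
qed

lemma reachable_mono:
  assumes "reachable K c J Z u" "\<And>y. c y \<le> c' y" "\<And>y. Z' y \<subseteq> Z y"
  shows "reachable K c' J Z' u"
  using assms(1)
proof (induction rule: reachable.induct)
  case (jump u x)
  have "(of_bool (u x \<in> Z' x) :: nat) \<le> of_bool (u x \<in> Z x)" using assms(3)[of x] by auto
  then have "can_jump K c' J Z' u x" using jump.hyps(3) assms(2)[of x] unfolding can_jump_def by linarith
  with jump show ?case by (intro reachable.jump) auto
qed (rule reachable.zero)

text \<open>
  A run without sleep marks at \<open>x\<close> uses one particle per jump; the additional particle means that \<open>x\<close>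
  holds two whenever it jumps, so that marks at \<open>x\<close> cannot stop it.
\<close>

lemma reachable_add_particle:
  assumes "reachable K c J (Z(x := {})) u"
  shows "reachable K (c(x := Suc (c x))) J (Z(x := B)) u" (is "reachable K ?c J ?Z u")
  using assms
proof (induction rule: reachable.induct)
  case (jump u y)
  have "can_jump K ?c J ?Z u y"
    using jump.hyps(3) by (auto simp: can_jump_def of_bool_def split: if_splits)
  with jump show ?case by (intro reachable.jump)
qed (rule reachable.zero)

lemma reachable_maximal:
  assumes "finite K"
  obtains u where "reachable K c J Z u" "u \<le> w"
    "\<And>y. y \<in> K \<Longrightarrow> u y < w y \<Longrightarrow> \<not> can_jump K c J Z u y"
proof -
  let ?P = "\<lambda>u. reachable K c J Z u \<and> u \<le> w"
  have "?P (\<lambda>_. 0)" by (auto intro: reachable.zero simp: le_fun_def)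
  moreover have "\<forall>u. ?P u \<longrightarrow> sum u K < Suc (sum w K)"
    by (auto simp: le_fun_def less_Suc_eq_le intro!: sum_mono)
  ultimately obtain u where u: "?P u" and max: "\<And>v. ?P v \<Longrightarrow> sum v K \<le> sum u K"
    using ex_has_greatest_nat[of ?P _ "\<lambda>u. sum u K"] by blast
  have "\<not> can_jump K c J Z u y" if y: "y \<in> K" "u y < w y" for y
  proof
    assume "can_jump K c J Z u y"
    with u y have "?P (u(y := Suc (u y)))"
      by (auto intro!: reachable.jump simp: le_fun_def)
    then have "sum (u(y := Suc (u y))) K \<le> sum u K" by (rule max)
    moreover have "sum (u(y := Suc (u y))) K > sum u K"
      by (rule sum_strict_mono_ex1) (use assms y in auto)
    ultimately show False by simp
  qed
  with u show ?thesis by (intro that) auto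
qed

text \<open>
  The abelian property: by the exchange lemma, a maximal reachable vector below the supremum
  dominates both vectors.
\<close>

lemma reachable_join:
  assumes K: "finite K" and u1: "reachable K c J Z u\<^sub>1" and u2: "reachable K c J Z u\<^sub>2"
  shows "reachable K c J Z (sup u\<^sub>1 u\<^sub>2)"
proof -
  obtain u where u: "reachable K c J Z u" "u \<le> sup u\<^sub>1 u\<^sub>2"
    "\<And>y. y \<in> K \<Longrightarrow> u y < sup u\<^sub>1 u\<^sub>2 y \<Longrightarrow> \<not> can_jump K c J Z u y"
    by (rule reachable_maximal[OF K, where w = "sup u\<^sub>1 u\<^sub>2"]) blast
  have "v \<le> u" if v: "reachable K c J Z v" "v \<le> sup u\<^sub>1 u\<^sub>2" for v
  proof (rule ccontr)
    assume "\<not> v \<le> u"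
    from reachable_exchange[OF v(1) this] obtain y
      where "y \<in> K" "u y < v y" "can_jump K c J Z u y" by blast
    moreover from v(2) have "v y \<le> sup u\<^sub>1 u\<^sub>2 y" by (rule le_funD)
    ultimately show False using u(3)[of y] by simp
  qed
  with u1 u2 have "sup u\<^sub>1 u\<^sub>2 \<le> u" by simp
  with u show ?thesis by (metis antisym)
qed

text \<open>
  This is what makes at most one sleep mark at \<open>x\<close> decisive. If the maximal run below the supremum
  dominates neither vector, then both exchange steps are blocked; since the mark sets differ only at
  \<open>x\<close>, both are blocked at \<open>x\<close> by the mark of the same index, which lies in \<open>B\<^sub>1 \<union> B\<^sub>2\<close> but in
  neither of \<open>B\<^sub>1\<close> and \<open>B\<^sub>2\<close>.
\<close>

lemma reachable_Un_sleeps: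
  assumes K: "finite K"
    and r1: "reachable K c J (Z(x := B\<^sub>1)) u\<^sub>1" and r2: "reachable K c J (Z(x := B\<^sub>2)) u\<^sub>2"
  obtains u where "reachable K c J (Z(x := B\<^sub>1 \<union> B\<^sub>2)) u" "u\<^sub>1 \<le> u \<or> u\<^sub>2 \<le> u" "u \<le> sup u\<^sub>1 u\<^sub>2"
proof -
  let ?Z = "Z(x := B\<^sub>1 \<union> B\<^sub>2)"
  obtain u where u: "reachable K c J ?Z u" "u \<le> sup u\<^sub>1 u\<^sub>2"
    and stuck: "\<And>y. y \<in> K \<Longrightarrow> u y < sup u\<^sub>1 u\<^sub>2 y \<Longrightarrow> \<not> can_jump K c J ?Z u y"
    by (rule reachable_maximal[OF K, where w = "sup u\<^sub>1 u\<^sub>2"]) blast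
  have "u\<^sub>1 \<le> u \<or> u\<^sub>2 \<le> u"
  proof (rule ccontr)
    assume "\<not> ?thesis"
    then have "\<not> u\<^sub>1 \<le> u" "\<not> u\<^sub>2 \<le> u" by auto
    then obtain y1 y2 where
      y1: "y1 \<in> K" "u y1 < u\<^sub>1 y1" "can_jump K c J (Z(x := B\<^sub>1)) u y1" and
      y2: "y2 \<in> K" "u y2 < u\<^sub>2 y2" "can_jump K c J (Z(x := B\<^sub>2)) u y2"
      using reachable_exchange[OF r1] reachable_exchange[OF r2] by blast
    have *: "\<not> can_jump K c J ?Z u y1" "\<not> can_jump K c J ?Z u y2"
      using stuck[of y1] stuck[of y2] y1 y2 by (auto simp: less_supI1 less_supI2)
    have "y1 = x" using * y1(3) by (auto simp: can_jump_def split: if_splits)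
    moreover have "y2 = x" using * y2(3) by (auto simp: can_jump_def split: if_splits)
    ultimately show False using * y1(3) y2(3) by (auto simp: can_jump_def of_bool_def split: if_splits)
  qed
  with u show ?thesis using that by blast
qed

lemma reachable_cong_prefix:
  assumes "reachable K c J Z u" "\<And>y. y \<in> K \<Longrightarrow> c' y = c y"
    "\<And>y k. y \<in> K \<Longrightarrow> k < u y \<Longrightarrow> J' y k = J y k \<and> (k \<in> Z' y \<longleftrightarrow> k \<in> Z y)"
  shows "reachable K c' J' Z' u"
  using assms(1,3)
proof (induction rule: reachable.induct)
  case (jump u x)
  have "arrivals K J' u x = arrivals K J u x"
    unfolding arrivals_def
  proof (intro sum.cong refl)
    fix y assume "y \<in> K"
    then have "k < u y \<Longrightarrow> J' y k = J y k" for k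
      using jump.prems[of y k] by (cases "y = x") auto
    then show "card {k. k < u y \<and> J' y k = x} = card {k. k < u y \<and> J y k = x}"
      by (intro arg_cong[of _ _ card]) auto
  qed
  moreover have "u x \<in> Z' x \<longleftrightarrow> u x \<in> Z x" using jump.prems[of x "u x"] jump.hyps by simp
  ultimately have "can_jump K c' J' Z' u x"
    using jump.hyps(2,3) assms(2) by (simp add: can_jump_def)
  moreover have "reachable K c' J' Z' u"
  proof (rule jump.IH)
    fix y k assume "y \<in> K" "k < u y"
    then show "J' y k = J y k \<and> (k \<in> Z' y \<longleftrightarrow> k \<in> Z y)"
      using jump.prems[of y k] by (cases "y = x") auto
  qed
  ultimately show ?case using jump.hyps(2) by (intro reachable.jump)
qed (rule reachable.zero)

section \<open>Instruction stacks in block form\<close>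

text \<open>
  The value is arbitrary when no jump follows; recurrent stacks exclude this.
\<close>

definition next_jump :: "(nat \<Rightarrow> 'v instr) \<Rightarrow> nat \<Rightarrow> nat" where
  "next_jump \<sigma> j = (LEAST i. j \<le> i \<and> \<sigma> i \<noteq> Sleep)"

primrec block_start :: "(nat \<Rightarrow> 'v instr) \<Rightarrow> nat \<Rightarrow> nat" where
  "block_start \<sigma> 0 = 0"
| "block_start \<sigma> (Suc k) = Suc (next_jump \<sigma> (block_start \<sigma> k))"

fun jump_target :: "'v instr \<Rightarrow> 'v" where
  "jump_target (Jump y) = y"
| "jump_target Sleep = undefined"

definition sleep_set :: "(nat \<Rightarrow> 'v instr) \<Rightarrow> nat set" where
  "sleep_set \<sigma> = {k. \<sigma> (block_start \<sigma> k) = Sleep}"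

definition nth_target :: "(nat \<Rightarrow> 'v instr) \<Rightarrow> nat \<Rightarrow> 'v" where
  "nth_target \<sigma> k = jump_target (\<sigma> (next_jump \<sigma> (block_start \<sigma> k)))"

definition recurrent :: "(nat \<Rightarrow> 'v instr) \<Rightarrow> bool" where
  "recurrent \<sigma> \<longleftrightarrow> (\<forall>j. \<exists>i\<ge>j. \<sigma> i \<noteq> Sleep)"

lemma next_jump:
  assumes "recurrent \<sigma>"
  shows next_jump_ge: "j \<le> next_jump \<sigma> j" and next_jump_not_Sleep: "\<sigma> (next_jump \<sigma> j) \<noteq> Sleep"
  using assms LeastI_ex[of "\<lambda>i. j \<le> i \<and> \<sigma> i \<noteq> Sleep"]
  unfolding recurrent_def next_jump_def by auto

lemma before_next_jump: "j \<le> i \<Longrightarrow> i < next_jump \<sigma> j \<Longrightarrow> \<sigma> i = Sleep"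
  unfolding next_jump_def using not_less_Least by blast

lemma next_jump_eqI: "j \<le> i \<Longrightarrow> i \<le> next_jump \<sigma> j \<Longrightarrow> \<sigma> i \<noteq> Sleep \<Longrightarrow> i = next_jump \<sigma> j"
  by (meson before_next_jump le_neq_implies_less)

fun site_count :: "site \<Rightarrow> nat" where
  "site_count (Active n) = n"
| "site_count Sleeping = 1"

definition used :: "('v \<times> nat) list \<Rightarrow> 'v \<Rightarrow> nat" where
  "used \<alpha> x = length (filter (\<lambda>p. fst p = x) \<alpha>)"

lemma used_simps [simp]:
  "used [] x = 0" "used (\<alpha> @ [p]) x = (if fst p = x then Suc (used \<alpha> x) else used \<alpha> x)"
  by (auto simp: used_def)

lemma jump_count_simps [simp]:
  "jump_count \<tau> [] x = 0"
  "jump_count \<tau> (\<alpha> @ [p]) x =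
     (if fst p = x \<and> \<tau> p \<noteq> Sleep then Suc (jump_count \<tau> \<alpha> x) else jump_count \<tau> \<alpha> x)"
  by (auto simp: jump_count_def)

lemma apply_seq_snoc [simp]:
  "apply_seq \<tau> (\<alpha> @ [p]) \<eta> = apply_instr (fst p) (\<tau> p) (apply_seq \<tau> \<alpha> \<eta>)"
  by (induction \<alpha> arbitrary: \<eta>) auto

lemma legal_seq_Nil [simp]: "legal_seq \<eta> \<tau> []"
  by (simp add: legal_seq_def)

lemma legal_seq_snoc:
  "legal_seq \<eta> \<tau> (\<alpha> @ [(x, j)]) \<longleftrightarrow>
     legal_seq \<eta> \<tau> \<alpha> \<and> j = used \<alpha> x \<and> unstable (apply_seq \<tau> \<alpha> \<eta>) x"
proof -
  let ?ns = "\<lambda>\<beta> y. map snd (filter (\<lambda>p. fst p = y) \<beta>)"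
  have len: "length (?ns \<alpha> y) = used \<alpha> y" for y by (simp add: used_def)
  have "(\<forall>y. ?ns (\<alpha> @ [(x, j)]) y = [0..<length (?ns (\<alpha> @ [(x, j)]) y)]) \<longleftrightarrow>
        (\<forall>y. ?ns \<alpha> y = [0..<length (?ns \<alpha> y)]) \<and> j = used \<alpha> x"
    (is "(\<forall>y. ?L y) \<longleftrightarrow> (\<forall>y. ?R y) \<and> _")
  proof -
    have "?L y \<longleftrightarrow> ?R y \<and> (y = x \<longrightarrow> j = used \<alpha> x)" for y
      using len[of y] by (auto)
    then show ?thesis by blast
  qed
  moreover have "(\<forall>i<length (\<alpha> @ [(x, j)]). unstable (apply_seq \<tau> (take i (\<alpha> @ [(x, j)])) \<eta>) (fst ((\<alpha> @ [(x, j)]) ! i)))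
     \<longleftrightarrow> (\<forall>i<length \<alpha>. unstable (apply_seq \<tau> (take i \<alpha>) \<eta>) (fst (\<alpha> ! i))) \<and> unstable (apply_seq \<tau> \<alpha> \<eta>) x"
    by (auto simp: nth_append less_Suc_eq)
  ultimately show ?thesis unfolding legal_seq_def Let_def by blast
qed

lemma arrivals_upd:
  assumes "finite K" "x \<in> K"
  shows "arrivals K J (u(x := Suc (u x))) y = arrivals K J u y + of_bool (J x (u x) = y)"
proof -
  have "{k. k < Suc (u x) \<and> J x k = y} = {k. k < u x \<and> J x k = y} \<union> (if J x (u x) = y then {u x} else {})"
    by (auto simp: less_Suc_eq)
  then have "card {k. k < Suc (u x) \<and> J x k = y} = card {k. k < u x \<and> J x k = y} + of_bool (J x (u x) = y)"
    by auto
  moreover have "(\<Sum>z\<in>K - {x}. card {k. k < (u(x := Suc (u x))) z \<and> J z k = y})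
      = (\<Sum>z\<in>K - {x}. card {k. k < u z \<and> J z k = y})"
    by (intro sum.cong) auto
  ultimately show ?thesis
    unfolding arrivals_def using assms by (simp add: sum.remove)
qed

definition stack :: "'v array \<Rightarrow> 'v \<Rightarrow> nat \<Rightarrow> 'v instr" where
  "stack \<tau> x = (\<lambda>j. \<tau> (x, j))"

abbreviation "targets \<tau> \<equiv> (\<lambda>x. nth_target (stack \<tau> x))"
abbreviation "sleeps \<tau> \<equiv> (\<lambda>x. sleep_set (stack \<tau> x))"

text \<open>
  What a legal sequence knows about the blocks: particles are conserved; each vertex stands inside its
  current block; a sleeping vertex has consumed a sleep instruction of that block; and conversely,
  once a vertex has consumed one, it is asleep or holds at least two particles. The last two
  clauses express that sleep instructions after the first one in a block change nothing.
\<close>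

definition block_invariant :: "'v set \<Rightarrow> ('v \<Rightarrow> nat) \<Rightarrow> 'v array \<Rightarrow> ('v \<times> nat) list \<Rightarrow> bool" where
  "block_invariant K c \<tau> \<alpha> \<longleftrightarrow>
    (let \<xi> = apply_seq \<tau> \<alpha> (\<lambda>y. Active (c y)); u = jump_count \<tau> \<alpha>; v = used \<alpha> in
      (\<forall>y. site_count (\<xi> y) + u y = c y + arrivals K (targets \<tau>) u y) \<and>
      (\<forall>y\<in>K. block_start (stack \<tau> y) (u y) \<le> v y \<and> v y \<le> next_jump (stack \<tau> y) (block_start (stack \<tau> y) (u y))) \<and>
      (\<forall>y. \<xi> y = Sleeping \<longrightarrow> block_start (stack \<tau> y) (u y) < v y) \<and>
      (\<forall>y\<in>K. block_start (stack \<tau> y) (u y) < v y \<longrightarrow> \<xi> y = Sleeping \<or> 2 \<le> site_count (\<xi> y)))"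

text \<open>
  Forgetting the sleep instructions turns a legal sequence into a run of the jump-only dynamics.
\<close>

lemma block_invariant_legal:
  assumes K: "finite K" and rec: "\<And>y. y \<in> K \<Longrightarrow> recurrent (stack \<tau> y)"
    and "legal_seq (\<lambda>y. Active (c y)) \<tau> \<alpha>" "fst ` set \<alpha> \<subseteq> K"
  shows "block_invariant K c \<tau> \<alpha> \<and> reachable K c (targets \<tau>) (sleeps \<tau>) (jump_count \<tau> \<alpha>)"
  using assms(3,4)
proof (induction \<alpha> rule: rev_induct)
  case Nil
  have "jump_count \<tau> [] = (\<lambda>_. 0)" by auto
  moreover have "block_invariant K c \<tau> []"
    by (auto simp: block_invariant_def arrivals_def)
  ultimately show ?case by (auto intro: reachable.zero)
next
  case (snoc p \<alpha>)
  obtain x j where p: "p = (x, j)" by (cases p)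
  define \<xi> where "\<xi> = apply_seq \<tau> \<alpha> (\<lambda>y. Active (c y))"
  define u where "u = jump_count \<tau> \<alpha>"
  define v where "v = used \<alpha>"
  define s where "s = block_start (stack \<tau> x) (u x)"
  have x: "x \<in> K" using snoc.prems p by auto
  have j: "j = v x" and un: "unstable \<xi> x" and leg: "legal_seq (\<lambda>y. Active (c y)) \<tau> \<alpha>"
    using snoc.prems(1) unfolding p legal_seq_snoc v_def \<xi>_def by auto
  have IH: "block_invariant K c \<tau> \<alpha>" "reachable K c (targets \<tau>) (sleeps \<tau>) u"
    using snoc.IH leg snoc.prems(2) by (auto simp: u_def)
  have I1: "\<And>y. site_count (\<xi> y) + u y = c y + arrivals K (targets \<tau>) u y"
    and I2: "\<And>y. y \<in> K \<Longrightarrow> block_start (stack \<tau> y) (u y) \<le> v y \<and> v y \<le> next_jump (stack \<tau> y) (block_start (stack \<tau> y) (u y))"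
    and I3: "\<And>y. \<xi> y = Sleeping \<Longrightarrow> block_start (stack \<tau> y) (u y) < v y"
    and I4: "\<And>y. y \<in> K \<Longrightarrow> block_start (stack \<tau> y) (u y) < v y \<Longrightarrow> \<xi> y = Sleeping \<or> 2 \<le> site_count (\<xi> y)"
    using IH(1) unfolding block_invariant_def Let_def \<xi>_def u_def v_def by blast+
  obtain n where n: "\<xi> x = Active n" "n \<ge> 1" using un by (auto simp: unstable_def)
  have st: "stack \<tau> x (v x) = \<tau> p" by (simp add: stack_def p j)
  have v': "used (\<alpha> @ [p]) = v(x := Suc (v x))" by (auto simp: v_def p)
  show ?case
  proof (cases "\<tau> p")
    case Sleep
    have u': "jump_count \<tau> (\<alpha> @ [p]) = u" by (auto simp: u_def Sleep)
    have "v x \<noteq> next_jump (stack \<tau> x) (block_start (stack \<tau> x) (u x))"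
      using next_jump_not_Sleep[OF rec[OF x]] st Sleep by metis
    moreover have "apply_seq \<tau> (\<alpha> @ [p]) (\<lambda>y. Active (c y)) = (if n = 1 then \<xi>(x := Sleeping) else \<xi>)"
      using n Sleep by (auto simp: \<xi>_def p)
    ultimately have \<xi>': "\<And>y. apply_seq \<tau> (\<alpha> @ [p]) (\<lambda>y. Active (c y)) y =
        (if y = x \<and> n = 1 then Sleeping else \<xi> y)"
      and vx: "Suc (v x) \<le> next_jump (stack \<tau> x) (block_start (stack \<tau> x) (u x))"
      using I2[OF x] by auto
    have "block_invariant K c \<tau> (\<alpha> @ [p])"
      unfolding block_invariant_def Let_def u' v' \<xi>'
    proof (intro conjI allI ballI impI)
      fix y
      show "site_count (if y = x \<and> n = 1 then Sleeping else \<xi> y) + u y =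
          c y + arrivals K (targets \<tau>) u y"
        using I1[of y] n by auto
      show "block_start (stack \<tau> y) (u y) < (v(x := Suc (v x))) y"
        if "(if y = x \<and> n = 1 then Sleeping else \<xi> y) = Sleeping"
        using that I3[of y] I2[OF x] n by (cases "y = x") auto
      assume y: "y \<in> K"
      show "block_start (stack \<tau> y) (u y) \<le> (v(x := Suc (v x))) y"
        "(v(x := Suc (v x))) y \<le> next_jump (stack \<tau> y) (block_start (stack \<tau> y) (u y))"
        using I2[OF y] vx by auto
      show "(if y = x \<and> n = 1 then Sleeping else \<xi> y) = Sleeping \<or>
          2 \<le> site_count (if y = x \<and> n = 1 then Sleeping else \<xi> y)"
        if "block_start (stack \<tau> y) (u y) < (v(x := Suc (v x))) y"
        using that I4[OF y] n by (cases "y = x") auto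
    qed
    with IH u' show ?thesis by simp
  next
    case (Jump z)
    have u': "jump_count \<tau> (\<alpha> @ [p]) = u(x := Suc (u x))"
      using Jump by (auto simp: u_def p fun_eq_iff)
    have vx: "v x = next_jump (stack \<tau> x) s"
      using I2[OF x] st Jump unfolding s_def by (intro next_jump_eqI) auto
    \<comment> \<open>A lone particle that jumps has not consumed a sleep instruction of the current block, which
      therefore starts with the jump itself.\<close>
    have "can_jump K c (targets \<tau>) (sleeps \<tau>) u x"
    proof (cases "2 \<le> n")
      case True
      then show ?thesis using I1[of x] n by (auto simp: can_jump_def)
    next
      case False
      then have "v x = s" using I4[OF x] I2[OF x] n unfolding s_def by fastforce
      then have "u x \<notin> sleep_set (stack \<tau> x)" using st Jump by (simp add: sleep_set_def s_def)
      then show ?thesis using I1[of x] n by (auto simp: can_jump_def)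
    qed
    then have r: "reachable K c (targets \<tau>) (sleeps \<tau>) (u(x := Suc (u x)))"
      using IH(2) x by (intro reachable.jump)
    have tz: "nth_target (stack \<tau> x) (u x) = z"
      using vx st Jump by (simp add: nth_target_def s_def)
    define \<xi>' where "\<xi>' = apply_seq \<tau> (\<alpha> @ [p]) (\<lambda>y. Active (c y))"
    have \<xi>': "\<xi>' = (let \<eta>' = \<xi>(x := Active (n - 1)) in \<eta>'(z := add_particle (\<eta>' z)))"
      using n Jump by (simp add: \<xi>'_def \<xi>_def p)
    have add: "site_count (add_particle t) = Suc (site_count t)" for t by (cases t) auto
    have add2: "add_particle t \<noteq> Sleeping" for t by (cases t) auto
    have c1: "site_count (\<xi>' y) + (u(x := Suc (u x))) y = c y + arrivals K (targets \<tau>) (u(x := Suc (u x))) y" for y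
      using I1[of y] n unfolding arrivals_upd[OF K x] \<xi>' by (auto simp: Let_def tz add)
    have c2: "block_start (stack \<tau> x) (Suc (u x)) = Suc (v x)" by (simp add: vx s_def)
    have c3: "Suc (v x) \<le> next_jump (stack \<tau> x) (Suc (v x))"
      by (rule next_jump_ge[OF rec[OF x]])
    have c4: "\<xi>' y = Sleeping \<Longrightarrow> y \<noteq> x \<and> \<xi> y = Sleeping" for y
      unfolding \<xi>' by (auto simp: Let_def add2 split: if_splits)
    have c5: "\<xi>' y = Sleeping \<or> 2 \<le> site_count (\<xi>' y)" if "y \<noteq> x" "\<xi> y = Sleeping \<or> 2 \<le> site_count (\<xi> y)" for y
      using that unfolding \<xi>' by (auto simp: Let_def add)
    have "block_invariant K c \<tau> (\<alpha> @ [p])"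
      unfolding block_invariant_def Let_def u' v' \<xi>'_def[symmetric]
    proof (intro conjI allI ballI impI)
      fix y
      show "site_count (\<xi>' y) + (u(x := Suc (u x))) y = c y + arrivals K (targets \<tau>) (u(x := Suc (u x))) y"
        by (rule c1)
      show "block_start (stack \<tau> y) ((u(x := Suc (u x))) y) < (v(x := Suc (v x))) y" if "\<xi>' y = Sleeping"
        using c4[OF that] I3 by auto
      assume y: "y \<in> K"
      show "block_start (stack \<tau> y) ((u(x := Suc (u x))) y) \<le> (v(x := Suc (v x))) y"
        using I2[OF y] c2 by (cases "y = x") auto
      show "(v(x := Suc (v x))) y \<le> next_jump (stack \<tau> y) (block_start (stack \<tau> y) ((u(x := Suc (u x))) y))"
        using I2[OF y] c2 c3 by (cases "y = x") (auto simp del: block_start.simps)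
      show "\<xi>' y = Sleeping \<or> 2 \<le> site_count (\<xi>' y)"
        if "block_start (stack \<tau> y) ((u(x := Suc (u x))) y) < (v(x := Suc (v x))) y"
      proof -
        have "y \<noteq> x" using that c2 by (auto simp del: block_start.simps)
        with that I4[OF y] show ?thesis by (intro c5) auto
      qed
    qed
    with r show ?thesis unfolding u' by blast
  qed
qed

text \<open>
  Needed for blocks that are entered with at least two particles: each sleep instruction in turn is
  legal and leaves the configuration as it is.
\<close>

lemma use_sleeps:
  assumes "legal_seq \<eta> \<tau> \<alpha>" "x \<in> K" "fst ` set \<alpha> \<subseteq> K" "apply_seq \<tau> \<alpha> \<eta> x = Active n" "2 \<le> n"
    "\<And>i. i < d \<Longrightarrow> \<tau> (x, used \<alpha> x + i) = Sleep"
  shows "\<exists>\<beta>. legal_seq \<eta> \<tau> \<beta> \<and> fst ` set \<beta> \<subseteq> K \<and> apply_seq \<tau> \<beta> \<eta> = apply_seq \<tau> \<alpha> \<eta> \<and>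
    jump_count \<tau> \<beta> = jump_count \<tau> \<alpha> \<and> used \<beta> = (used \<alpha>)(x := used \<alpha> x + d)"
  using assms(6)
proof (induction d)
  case 0
  show ?case using assms by (intro exI[of _ \<alpha>]) auto
next
  case (Suc d)
  then obtain \<beta> where \<beta>: "legal_seq \<eta> \<tau> \<beta>" "fst ` set \<beta> \<subseteq> K" "apply_seq \<tau> \<beta> \<eta> = apply_seq \<tau> \<alpha> \<eta>"
    "jump_count \<tau> \<beta> = jump_count \<tau> \<alpha>" "used \<beta> = (used \<alpha>)(x := used \<alpha> x + d)"
    using less_SucI by blast
  let ?p = "(x, used \<alpha> x + d)"
  have S: "\<tau> ?p = Sleep" using Suc.prems[of d] by simp
  show ?case
    using \<beta> S assms(2,4,5)
    by (intro exI[of _ "\<beta> @ [?p]"]) (auto simp: legal_seq_snoc unstable_def fun_eq_iff)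
qed

text \<open>
  Conversely, sleep instructions are inserted just before each jump. Every vertex is then always at
  the start of a block, so none is asleep, and a block that contains sleep instructions is entered
  only when the vertex holds two particles.
\<close>

lemma legal_of_reachable:
  assumes K: "finite K" and rec: "\<And>y. y \<in> K \<Longrightarrow> recurrent (stack \<tau> y)"
    and "reachable K c (targets \<tau>) (sleeps \<tau>) u"
  shows "\<exists>\<alpha>. legal_seq (\<lambda>y. Active (c y)) \<tau> \<alpha> \<and> fst ` set \<alpha> \<subseteq> K \<and> jump_count \<tau> \<alpha> = u \<and>
    (\<forall>y\<in>K. used \<alpha> y = block_start (stack \<tau> y) (u y))"
  using assms(3)
proof (induction rule: reachable.induct)
  case zero
  show ?case by (intro exI[of _ "[]"]) (auto simp: fun_eq_iff)
next
  case (jump u x)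
  then obtain \<alpha> where \<alpha>: "legal_seq (\<lambda>y. Active (c y)) \<tau> \<alpha>" "fst ` set \<alpha> \<subseteq> K" "jump_count \<tau> \<alpha> = u"
    "\<And>y. y \<in> K \<Longrightarrow> used \<alpha> y = block_start (stack \<tau> y) (u y)" by blast
  define \<xi> where "\<xi> = apply_seq \<tau> \<alpha> (\<lambda>y. Active (c y))"
  define s where "s = block_start (stack \<tau> x) (u x)"
  define t where "t = next_jump (stack \<tau> x) s"
  have vx: "used \<alpha> x = s" using \<alpha>(4) jump.hyps by (simp add: s_def)
  have st: "s \<le> t" and tj: "\<tau> (x, t) \<noteq> Sleep"
    using next_jump[OF rec[OF jump.hyps(2)], of s] by (auto simp: t_def stack_def)
  have inv: "block_invariant K c \<tau> \<alpha>" using block_invariant_legal[OF K rec \<alpha>(1,2)] by simp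
  have I1: "site_count (\<xi> x) + u x = c x + arrivals K (targets \<tau>) u x"
    and I3: "\<xi> x = Sleeping \<Longrightarrow> s < used \<alpha> x"
    using inv unfolding block_invariant_def Let_def \<alpha>(3) \<xi>_def s_def by blast+
  from I3 vx obtain n where n: "\<xi> x = Active n" by (cases "\<xi> x") auto
  have n1: "1 + of_bool (u x \<in> sleep_set (stack \<tau> x)) \<le> n"
    using jump.hyps(3) I1 n by (auto simp: can_jump_def)
  have "\<exists>\<beta>. legal_seq (\<lambda>y. Active (c y)) \<tau> \<beta> \<and> fst ` set \<beta> \<subseteq> K \<and> apply_seq \<tau> \<beta> (\<lambda>y. Active (c y)) = \<xi> \<and>
    jump_count \<tau> \<beta> = u \<and> used \<beta> = (used \<alpha>)(x := t)"
  proof (cases "s = t")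
    case True
    with \<alpha> vx show ?thesis by (intro exI[of _ \<alpha>]) (auto simp: \<xi>_def)
  next
    case False
    then have "\<tau> (x, s) = Sleep"
      using before_next_jump[of s s "stack \<tau> x"] st by (auto simp: t_def stack_def)
    then have "u x \<in> sleep_set (stack \<tau> x)" by (simp add: sleep_set_def stack_def s_def)
    with n1 have "2 \<le> n" by simp
    moreover have "\<tau> (x, used \<alpha> x + i) = Sleep" if "i < t - s" for i
      using before_next_jump[of s "s + i" "stack \<tau> x"] that vx by (auto simp: t_def stack_def)
    ultimately show ?thesis
      using use_sleeps[of "\<lambda>y. Active (c y)" \<tau> \<alpha> x K n "t - s"] \<alpha> jump.hyps(2) n vx st
      by (auto simp: \<xi>_def)
  qed
  then obtain \<beta> where \<beta>: "legal_seq (\<lambda>y. Active (c y)) \<tau> \<beta>" "fst ` set \<beta> \<subseteq> K" "apply_seq \<tau> \<beta> (\<lambda>y. Active (c y)) = \<xi>"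
    "jump_count \<tau> \<beta> = u" "used \<beta> = (used \<alpha>)(x := t)" by blast
  show ?case
    using \<beta> n n1 tj jump.hyps(2) \<alpha>(4)
    by (intro exI[of _ "\<beta> @ [(x, t)]"])
       (auto simp: legal_seq_snoc unstable_def fun_eq_iff t_def s_def)
qed

text \<open>
  The odometer bounds at the different vertices, each witnessed by its own sequence, are attained
  simultaneously because reachable vectors are closed under suprema.
\<close>

lemma jump_odometer_iff_reachable:
  assumes K: "finite K" and rec: "\<And>y. y \<in> K \<Longrightarrow> recurrent (stack \<tau> y)"
  shows "(\<forall>x\<in>K. enat (H x) \<le> jump_odometer K (\<lambda>y. Active (c y)) \<tau> x) \<longleftrightarrow>
    (\<exists>u. reachable K c (targets \<tau>) (sleeps \<tau>) u \<and> (\<forall>x\<in>K. H x \<le> u x))"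
proof
  assume L: "\<forall>x\<in>K. enat (H x) \<le> jump_odometer K (\<lambda>y. Active (c y)) \<tau> x"
  have single: "\<exists>u. reachable K c (targets \<tau>) (sleeps \<tau>) u \<and> H x \<le> u x" if "x \<in> K" for x
  proof -
    let ?S = "{\<alpha>. legal_seq (\<lambda>y. Active (c y)) \<tau> \<alpha> \<and> fst ` set \<alpha> \<subseteq> K}"
    have "\<exists>\<alpha>\<in>?S. enat (H x) \<le> enat (jump_count \<tau> \<alpha> x)"
    proof (cases "H x")
      case 0
      then show ?thesis by (intro bexI[of _ "[]"]) auto
    next
      case (Suc h)
      have "enat h < jump_odometer K (\<lambda>y. Active (c y)) \<tau> x"
        using L that Suc by (metis enat_ord_simps(2) lessI less_le_trans)
      then obtain \<alpha> where "\<alpha> \<in> ?S" "enat h < enat (jump_count \<tau> \<alpha> x)"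
        unfolding jump_odometer_def less_SUP_iff by blast
      then show ?thesis using Suc by (intro bexI[of _ \<alpha>]) auto
    qed
    then show ?thesis using block_invariant_legal[OF K rec] by fastforce
  qed
  have "\<exists>u. reachable K c (targets \<tau>) (sleeps \<tau>) u \<and> (\<forall>x\<in>F. H x \<le> u x)" if "F \<subseteq> K" "finite F" for F
    using that(2,1)
  proof (induction F)
    case empty
    then show ?case using reachable.zero by fastforce
  next
    case (insert x F)
    then obtain u v where u: "reachable K c (targets \<tau>) (sleeps \<tau>) u" "\<forall>x\<in>F. H x \<le> u x"
      and v: "reachable K c (targets \<tau>) (sleeps \<tau>) v" "H x \<le> v x"
      using single[of x] by blast
    have "reachable K c (targets \<tau>) (sleeps \<tau>) (sup u v)" by (rule reachable_join[OF K u(1) v(1)])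
    moreover have "\<forall>y\<in>insert x F. H y \<le> sup u v y" using u v by (auto intro: le_supI1 le_supI2)
    ultimately show ?case by blast
  qed
  with K show "\<exists>u. reachable K c (targets \<tau>) (sleeps \<tau>) u \<and> (\<forall>x\<in>K. H x \<le> u x)" by blast
next
  assume "\<exists>u. reachable K c (targets \<tau>) (sleeps \<tau>) u \<and> (\<forall>x\<in>K. H x \<le> u x)"
  then obtain u where u: "reachable K c (targets \<tau>) (sleeps \<tau>) u" "\<forall>x\<in>K. H x \<le> u x" by blast
  from legal_of_reachable[OF K rec u(1)] obtain \<alpha> where
    "legal_seq (\<lambda>y. Active (c y)) \<tau> \<alpha>" "fst ` set \<alpha> \<subseteq> K" "jump_count \<tau> \<alpha> = u" by blast
  then have "enat (u x) \<le> jump_odometer K (\<lambda>y. Active (c y)) \<tau> x" for x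
    unfolding jump_odometer_def by (intro SUP_upper2[of \<alpha>]) auto
  then show "\<forall>x\<in>K. enat (H x) \<le> jump_odometer K (\<lambda>y. Active (c y)) \<tau> x"
    using u(2) by (meson enat_ord_simps(1) order_trans)
qed

section \<open>One vertex: the threshold form of the event\<close>

text \<open>
  The three properties to which the dynamics at one vertex reduce; they already force the threshold
  form below.
\<close>

definition particle_sleep_event :: "(nat \<Rightarrow> nat set \<Rightarrow> bool) \<Rightarrow> bool" where
  "particle_sleep_event G \<longleftrightarrow>
     (\<forall>n B B'. B' \<subseteq> B \<longrightarrow> G n B \<longrightarrow> G n B') \<and>
     (\<forall>n B. G n {} \<longrightarrow> G (Suc n) B) \<and>
     (\<forall>n B B'. G n B \<longrightarrow> G n B' \<longrightarrow> G n (B \<union> B'))"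

text \<open>
  At the least \<open>n\<^sub>0\<close> that is sufficient without marks, closure under union makes a finite set \<open>B\<close>
  admissible as soon as each of its singletons is; so \<open>S\<close> collects the individually harmful marks.
\<close>

lemma particle_sleep_event_cases:
  assumes "particle_sleep_event G"
  obtains (never) "\<And>n B. \<not> G n B"
  | (threshold) n\<^sub>0 S where "\<And>n B. finite B \<Longrightarrow> G n B \<longleftrightarrow> n\<^sub>0 < n \<or> n = n\<^sub>0 \<and> B \<inter> S = {}"
proof (cases "\<exists>n. G n {}")
  case False
  then have "\<not> G n B" for n B using assms unfolding particle_sleep_event_def by blast
  then show ?thesis by (rule never)
next
  case True
  have anti: "\<And>n B B'. B' \<subseteq> B \<Longrightarrow> G n B \<Longrightarrow> G n B'"
    and step: "\<And>n B. G n {} \<Longrightarrow> G (Suc n) B"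
    and un: "\<And>n B B'. G n B \<Longrightarrow> G n B' \<Longrightarrow> G n (B \<union> B')"
    using assms unfolding particle_sleep_event_def by blast+
  define n\<^sub>0 where "n\<^sub>0 = (LEAST n. G n {})"
  have n0: "G n\<^sub>0 {}" unfolding n\<^sub>0_def using True by (rule LeastI_ex)
  have below: "\<not> G n B" if "n < n\<^sub>0" for n B
    using not_less_Least[OF that[unfolded n\<^sub>0_def]] anti[of "{}" B n] by blast
  have "G (n\<^sub>0 + Suc k) B" for k B
    by (induction k arbitrary: B) (use n0 step in auto)
  then have above: "G n B" if "n\<^sub>0 < n" for n B
    using less_imp_Suc_add[OF that] by auto
  have "G n\<^sub>0 B \<longleftrightarrow> B \<inter> {i. \<not> G n\<^sub>0 {i}} = {}" if "finite B" for B
  proof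
    assume "G n\<^sub>0 B"
    then show "B \<inter> {i. \<not> G n\<^sub>0 {i}} = {}" using anti[of "{_}" B n\<^sub>0] by auto
  next
    assume "B \<inter> {i. \<not> G n\<^sub>0 {i}} = {}"
    with that show "G n\<^sub>0 B"
    proof (induction B)
      case (insert i B)
      then show ?case using un[of n\<^sub>0 "{i}" B] by auto
    qed (rule n0)
  qed
  with below above show ?thesis
    by (intro threshold[of n\<^sub>0 "{i. \<not> G n\<^sub>0 {i}}"]) (metis linorder_cases)
qed

definition true_indices :: "bool list \<Rightarrow> nat set" where
  "true_indices bs = {i. i < length bs \<and> bs ! i}"

lemma finite_true_indices [simp]: "finite (true_indices bs)"
  by (simp add: true_indices_def)

lemma true_indices_Cons_disjoint:
  "true_indices (b # bs) \<inter> S = {} \<longleftrightarrow> (b \<longrightarrow> 0 \<notin> S) \<and> true_indices bs \<inter> {i. Suc i \<in> S} = {}"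
proof -
  have "i \<in> true_indices (b # bs) \<longleftrightarrow> i = 0 \<and> b \<or> (\<exists>k. i = Suc k \<and> k \<in> true_indices bs)" for i
    by (cases i) (auto simp: true_indices_def)
  then show ?thesis by auto
qed

text \<open>
  The exponent is the number of elements of \<open>S\<close> below \<open>N\<close>; all that is needed of it is that it does
  not depend on \<open>p\<close>.
\<close>

lemma prob_true_indices_disjoint:
  "\<exists>j. \<forall>p\<in>{0..1}. measure (replicate_pmf N (bernoulli_pmf p)) {bs. true_indices bs \<inter> S = {}} = (1 - p) ^ j"
proof (induction N arbitrary: S)
  case 0
  show ?case by (intro exI[of _ 0]) (auto simp: true_indices_def measure_return_pmf indicator_def)
next
  case (Suc N)
  define S' where "S' = {i. Suc i \<in> S}"
  obtain j where j: "\<And>p. p \<in> {0..1} \<Longrightarrow>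
      measure (replicate_pmf N (bernoulli_pmf p)) {bs. true_indices bs \<inter> S' = {}} = (1 - p) ^ j"
    using Suc.IH[of S'] by blast
  let ?R = "\<lambda>p. replicate_pmf N (bernoulli_pmf p)"
  have "measure (replicate_pmf (Suc N) (bernoulli_pmf p)) {bs. true_indices bs \<inter> S = {}} =
      (1 - p) ^ (if 0 \<in> S then Suc j else j)" if p: "p \<in> {0..1}" for p
  proof -
    have "replicate_pmf (Suc N) (bernoulli_pmf p) =
        bernoulli_pmf p \<bind> (\<lambda>b. map_pmf ((#) b) (?R p))"
      by (simp add: map_pmf_def)
    then have "emeasure (replicate_pmf (Suc N) (bernoulli_pmf p)) {bs. true_indices bs \<inter> S = {}} =
       (\<integral>\<^sup>+b. emeasure (?R p) {bs. (b \<longrightarrow> 0 \<notin> S) \<and> true_indices bs \<inter> S' = {}} \<partial>bernoulli_pmf p)"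
      by (simp add: vimage_def true_indices_Cons_disjoint S'_def)
    also have "\<dots> = ennreal p * emeasure (?R p) {bs. 0 \<notin> S \<and> true_indices bs \<inter> S' = {}} +
        ennreal (1 - p) * emeasure (?R p) {bs. true_indices bs \<inter> S' = {}}"
      using p by (simp add: mult.commute)
    also have "\<dots> = ennreal ((1 - p) ^ (if 0 \<in> S then Suc j else j))"
    proof (cases "0 \<in> S")
      case True
      then show ?thesis using p j by (simp add: measure_pmf.emeasure_eq_measure ennreal_mult')
    next
      case False
      then show ?thesis using p j[OF p]
        by (simp add: measure_pmf.emeasure_eq_measure flip: ennreal_mult'' ennreal_plus)
           (simp add: algebra_simps)
    qed
    finally show ?thesis using p by (simp add: measure_pmf.emeasure_eq_measure)
  qed
  then show ?case by blast
qed

definition poisson_term :: "nat \<Rightarrow> real \<Rightarrow> real" where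
  "poisson_term n m = m ^ n / fact n * exp (- m)"

lemma DERIV_poisson_term_Suc:
  "(poisson_term (Suc n) has_real_derivative (poisson_term n m - poisson_term (Suc n) m)) (at m)"
proof -
  have "((\<lambda>m. m ^ Suc n / fact (Suc n)) has_real_derivative m ^ n / fact n) (at m)"
    using DERIV_cdivide[OF DERIV_pow[of "Suc n" m], of "fact (Suc n)"] by (simp del: of_nat_Suc)
  moreover have "((\<lambda>m. exp (- m)) has_real_derivative - exp (- m)) (at m)"
    by (auto intro!: derivative_eq_intros)
  ultimately have "((\<lambda>m. m ^ Suc n / fact (Suc n) * exp (- m)) has_real_derivative
      m ^ n / fact n * exp (- m) + - exp (- m) * (m ^ Suc n / fact (Suc n))) (at m)"
    by (rule DERIV_mult)
  then show ?thesis unfolding poisson_term_def by (simp add: mult.commute)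
qed

lemma DERIV_poisson_sum:
  "((\<lambda>m. \<Sum>i\<le>n. poisson_term i m) has_real_derivative - poisson_term n m) (at m)"
proof (induction n)
  case 0
  show ?case by (auto simp: poisson_term_def intro!: derivative_eq_intros)
next
  case (Suc n)
  from DERIV_add[OF Suc DERIV_poisson_term_Suc[of n m]] show ?case by simp
qed

lemma DERIV_poisson_term:
  "\<exists>D. (poisson_term n has_real_derivative D - poisson_term n m) (at m) \<and> (0 \<le> m \<longrightarrow> 0 \<le> D)"
proof (cases n)
  case 0
  have "(poisson_term n has_real_derivative 0 - poisson_term n m) (at m)"
    unfolding poisson_term_def 0 by (auto intro!: derivative_eq_intros)
  then show ?thesis by blast
next
  case (Suc k)
  have "0 \<le> m \<longrightarrow> 0 \<le> poisson_term k m" by (simp add: poisson_term_def)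
  with DERIV_poisson_term_Suc[of k m] show ?thesis unfolding Suc by blast
qed

text \<open>
  The probability of \<open>N > n \<or> (N = n \<and> none of j given marks is present)\<close> for a Poisson variable \<open>N\<close>
  with mean \<open>m\<close> and independent marks of probability \<open>l / (1 + l)\<close>.
\<close>

definition threshold_prob :: "nat \<Rightarrow> nat \<Rightarrow> real \<Rightarrow> real \<Rightarrow> real" where
  "threshold_prob n j l m = 1 - (\<Sum>i\<le>n. poisson_term i m) + poisson_term n m * (1 / (1 + l)) ^ j"

text \<open>
  The function is nondecreasing along the segment between the two parameter pairs: its derivative is
  the gain from the larger Poisson mean minus the loss from the additional sleep marks, and
  Bernoulli's inequality compares the two exactly at the slope that defines the region.
\<close>

lemma threshold_prob_mono:
  assumes "l > 0" "m > 0" and region: "(l', m') \<in> param_region l m"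
  shows "threshold_prob n j l m \<le> threshold_prob n j l' m'"
proof -
  define a where "a = l' - l"
  define d where "d = m' - m"
  have a: "0 \<le> a" and d: "a / (l * (1 + l)) \<le> d"
    using region by (auto simp: param_region_def a_def d_def)
  define F where "F t = threshold_prob n j (l + t * a) (m + t * d)" for t
  have "F 0 \<le> F 1"
  proof (rule DERIV_nonneg_imp_nondecreasing[where f = F and a = 0 and b = 1])
    fix t :: real assume t: "0 \<le> t" "t \<le> 1"
    have d0: "0 \<le> d" using a d assms(1) by (meson divide_nonneg_pos mult_pos_pos add_pos_pos zero_less_one order_trans)
    define lt where "lt = l + t * a"
    define mt where "mt = m + t * d"
    have lt: "l \<le> lt" using t a by (simp add: lt_def)
    have mt: "0 \<le> mt" using t d0 assms(2) by (simp add: mt_def)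
    define w where "w = (1 / (1 + lt)) ^ j"
    define q where "q = poisson_term n mt"
    have q: "0 \<le> q" using mt by (simp add: q_def poisson_term_def)
    have w: "0 \<le> w" using lt assms(1) by (simp add: w_def)
    obtain D where D: "(poisson_term n has_real_derivative D - q) (at mt)" "0 \<le> D"
      using DERIV_poisson_term[of n mt] mt by (auto simp: q_def)
    have Dm: "((\<lambda>t. m + t * d) has_real_derivative d) (at t)"
      by (auto intro!: derivative_eq_intros)
    have Dl: "((\<lambda>t. (1 / (1 + (l + t * a))) ^ j) has_real_derivative - (real j * w / (1 + lt) * a)) (at t)"
    proof (cases j)
      case (Suc k)
      have "((\<lambda>t. 1 / (1 + (l + t * a))) has_real_derivative - (a / (1 + lt)^2)) (at t)"
        using lt assms(1)
        by (auto intro!: derivative_eq_intros simp: lt_def power2_eq_square add_nonneg_eq_0_iff)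
      from DERIV_power[OF this, of "Suc k"] show ?thesis
        unfolding Suc w_def by (simp add: power2_eq_square lt_def mult_ac)
    qed (simp add: w_def)
    have 1: "((\<lambda>t. \<Sum>i\<le>n. poisson_term i (m + t * d)) has_real_derivative - q * d) (at t)"
      using DERIV_chain2[OF DERIV_poisson_sum Dm] by (simp add: q_def mt_def)
    have 2: "((\<lambda>t. poisson_term n (m + t * d)) has_real_derivative (D - q) * d) (at t)"
      using DERIV_chain2[OF _ Dm] D(1) by (simp add: mt_def)
    have "(F has_real_derivative (0 - (- q * d) + ((D - q) * d * w + (- (real j * w / (1 + lt) * a)) * q))) (at t)"
      unfolding F_def threshold_prob_def
      using DERIV_add[OF DERIV_diff[OF DERIV_const 1] DERIV_mult[OF 2 Dl]]
      by (simp add: q_def w_def lt_def mt_def)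
    \<comment> \<open>The derivative is \<open>d q (1 - w) + d D w - a q j w / (1 + lt)\<close>, where \<open>D w d \<ge> 0\<close> is dropped.\<close>
    moreover have "0 \<le> 0 - (- q * d) + ((D - q) * d * w + (- (real j * w / (1 + lt) * a)) * q)"
    proof -
      have "1 + real j * lt \<le> (1 + lt) ^ j"
        using Bernoulli_inequality[of lt j] lt assms(1) by simp
      then have "w * (1 + real j * lt) \<le> 1"
        using lt assms(1) by (simp add: w_def power_divide divide_simps)
      then have bern: "real j * w * lt \<le> 1 - w" by (simp add: algebra_simps)
      have "0 \<le> real j * w * lt" using w lt assms(1) by simp
      with bern have w1: "0 \<le> 1 - w" by linarith
      have "l * (1 + l) \<le> lt * (1 + lt)" using lt assms(1) by (intro mult_mono) auto
      then have "a / (lt * (1 + lt)) \<le> a / (l * (1 + l))"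
        using a assms(1) lt by (intro divide_left_mono) auto
      with d have ad: "a / (lt * (1 + lt)) \<le> d" by linarith
      have "real j * w / (1 + lt) * a = (real j * w * lt) * (a / (lt * (1 + lt)))"
        using lt assms(1) by (simp flip: divide_divide_eq_left)
      also have "\<dots> \<le> (1 - w) * d"
        using w1 bern ad d0 a lt assms(1) w by (intro mult_mono) auto
      finally have "(real j * w / (1 + lt) * a) * q \<le> (1 - w) * d * q"
        using q by (rule mult_right_mono)
      moreover have "0 \<le> D * d * w" using D(2) d0 w by simp
      ultimately show ?thesis by (simp add: algebra_simps)
    qed
    ultimately show "\<exists>y. (F has_real_derivative y) (at t) \<and> 0 \<le> y" by blast
  qed simp
  then show ?thesis by (simp add: F_def a_def d_def)
qed

lemma prob_particle_sleep_event_mono: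
  fixes N :: nat
  assumes G: "particle_sleep_event G" and lm: "l > 0" "m > 0" "(l', m') \<in> param_region l m"
  defines "P \<equiv> (\<lambda>l m. pair_pmf (poisson_pmf m) (replicate_pmf N (bernoulli_pmf (l / (1 + l)))))"
  shows "measure (P l m) {(n, bs). G n (true_indices bs)} \<le> measure (P l' m') {(n, bs). G n (true_indices bs)}"
  using G
proof (cases rule: particle_sleep_event_cases)
  case never
  then show ?thesis by simp
next
  case (threshold n\<^sub>0 S)
  obtain j where j: "\<And>p. p \<in> {0..1} \<Longrightarrow>
      measure (replicate_pmf N (bernoulli_pmf p)) {bs. true_indices bs \<inter> S = {}} = (1 - p) ^ j"
    using prob_true_indices_disjoint[of N S] by blast
  have prob: "measure (P l m) {(n, bs). G n (true_indices bs)} = threshold_prob n\<^sub>0 j l m"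
    if "l > 0" "m > 0" for l m
  proof -
    let ?R = "replicate_pmf N (bernoulli_pmf (l / (1 + l)))"
    have "{(n, bs). G n (true_indices bs)} =
        {n\<^sub>0<..} \<times> UNIV \<union> {n\<^sub>0} \<times> {bs. true_indices bs \<inter> S = {}}"
      by (auto simp: threshold)
    then have "measure (P l m) {(n, bs). G n (true_indices bs)} =
        measure (P l m) ({n\<^sub>0<..} \<times> UNIV) + measure (P l m) ({n\<^sub>0} \<times> {bs. true_indices bs \<inter> S = {}})"
      by (simp only:) (rule measure_pmf.finite_measure_Union; auto)
    also have "measure (P l m) ({n\<^sub>0<..} \<times> UNIV) = measure (poisson_pmf m) {n\<^sub>0<..}"
      unfolding P_def by (subst measure_pmf_prob_product) auto
    also have "measure (poisson_pmf m) {n\<^sub>0<..} = 1 - measure (poisson_pmf m) {..n\<^sub>0}"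
      using measure_pmf.prob_compl[of "{..n\<^sub>0}" "poisson_pmf m"]
      by (simp add: Compl_eq_Diff_UNIV[symmetric] not_le[symmetric] Compl_atMost)
    also have "measure (poisson_pmf m) {..n\<^sub>0} = (\<Sum>i\<le>n\<^sub>0. poisson_term i m)"
      using that by (subst measure_measure_pmf_finite) (auto simp: poisson_term_def)
    also have "measure (P l m) ({n\<^sub>0} \<times> {bs. true_indices bs \<inter> S = {}}) =
        measure (poisson_pmf m) {n\<^sub>0} * measure ?R {bs. true_indices bs \<inter> S = {}}"
      unfolding P_def by (subst measure_pmf_prob_product) auto
    also have "measure ?R {bs. true_indices bs \<inter> S = {}} = (1 - l / (1 + l)) ^ j"
      using that by (intro j) auto
    also have "1 - l / (1 + l) = 1 / (1 + l)" using that by (simp add: field_simps)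
    also have "measure (poisson_pmf m) {n\<^sub>0} = poisson_term n\<^sub>0 m"
      using that by (simp add: measure_pmf_single poisson_term_def)
    finally show ?thesis by (simp add: threshold_prob_def)
  qed
  have le: "l \<le> l'" and "1 / (l * (1 + l)) * (l' - l) + m \<le> m'" using lm by (auto simp: param_region_def)
  moreover have "1 / (l * (1 + l)) * (l' - l) \<ge> 0"
    using lm le by (intro mult_nonneg_nonneg divide_nonneg_nonneg) auto
  ultimately have "l' > 0" "m' > 0" using lm by linarith+
  with lm show ?thesis by (simp add: prob threshold_prob_mono)
qed

section \<open>The law of the blocks of an independent stack\<close>

definition block :: "(nat \<Rightarrow> 'v instr) \<Rightarrow> nat \<Rightarrow> bool \<times> 'v" where
  "block \<sigma> k = (k \<in> sleep_set \<sigma>, nth_target \<sigma> k)"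

definition blocks :: "nat \<Rightarrow> (nat \<Rightarrow> 'v instr) \<Rightarrow> (bool \<times> 'v) list" where
  "blocks N \<sigma> = map (block \<sigma>) [0..<N]"

lemma length_blocks [simp]: "length (blocks N \<sigma>) = N"
  by (simp add: blocks_def)

lemma blocks_eq_iff: "blocks N \<sigma> = ls \<longleftrightarrow> length ls = N \<and> (\<forall>k\<in>{..<N}. block \<sigma> k = ls ! k)"
  unfolding blocks_def by (subst list_eq_iff_nth_eq) auto

lemma next_jump_case_nat_Suc:
  assumes "recurrent \<sigma>"
  shows "next_jump (case_nat s \<sigma>) (Suc j) = Suc (next_jump \<sigma> j)"
proof -
  obtain i where "j \<le> i" "\<sigma> i \<noteq> Sleep" using assms by (auto simp: recurrent_def)
  then show ?thesis
    using Least_Suc[of "\<lambda>i. Suc j \<le> i \<and> case_nat s \<sigma> i \<noteq> Sleep" "Suc i"]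
    by (simp add: next_jump_def)
qed

lemma next_jump_case_nat_0:
  "next_jump (case_nat (Jump y) \<sigma>) 0 = 0"
  "recurrent \<sigma> \<Longrightarrow> next_jump (case_nat Sleep \<sigma>) 0 = Suc (next_jump \<sigma> 0)"
proof -
  show "next_jump (case_nat (Jump y) \<sigma>) 0 = 0" unfolding next_jump_def by (rule Least_eq_0) simp
  assume "recurrent \<sigma>"
  then obtain i where "\<sigma> i \<noteq> Sleep" by (auto simp: recurrent_def)
  then show "next_jump (case_nat Sleep \<sigma>) 0 = Suc (next_jump \<sigma> 0)"
    using Least_Suc[of "\<lambda>i. 0 \<le> i \<and> case_nat Sleep \<sigma> i \<noteq> Sleep" "Suc i"]
    by (simp add: next_jump_def)
qed

lemma block_start_case_nat:
  assumes "recurrent \<sigma>"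
  shows "block_start (case_nat (Jump y) \<sigma>) (Suc k) = Suc (block_start \<sigma> k)"
    "block_start (case_nat Sleep \<sigma>) (Suc k) = Suc (block_start \<sigma> (Suc k))"
  by (induction k) (simp_all add: next_jump_case_nat_0 next_jump_case_nat_Suc assms)

lemma block_case_nat:
  assumes "recurrent \<sigma>"
  shows "block (case_nat (Jump y) \<sigma>) 0 = (False, y)"
    "block (case_nat (Jump y) \<sigma>) (Suc k) = block \<sigma> k"
    "block (case_nat Sleep \<sigma>) 0 = (True, snd (block \<sigma> 0))"
    "block (case_nat Sleep \<sigma>) (Suc k) = block \<sigma> (Suc k)"
  using block_start_case_nat[OF assms]
  by (simp_all add: block_def sleep_set_def nth_target_def next_jump_case_nat_0 next_jump_case_nat_Suc assms
      del: block_start.simps(2))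

lemma blocks_case_nat:
  assumes "recurrent \<sigma>"
  shows "blocks (Suc N) (case_nat (Jump y) \<sigma>) = (False, y) # blocks N \<sigma>"
    "blocks (Suc N) (case_nat Sleep \<sigma>) = (True, snd (hd (blocks (Suc N) \<sigma>))) # tl (blocks (Suc N) \<sigma>)"
  using assms by (simp_all add: blocks_def upt_conv_Cons map_Suc_upt[symmetric] block_case_nat del: upt_Suc)

text \<open>
  The law of one instruction, separated from the graph.
\<close>

definition sleep_jump_pmf :: "real \<Rightarrow> 'v pmf \<Rightarrow> 'v instr pmf" where
  "sleep_jump_pmf p D = bernoulli_pmf p \<bind> (\<lambda>b. if b then return_pmf Sleep else map_pmf Jump D)"

definition stack_measure :: "real \<Rightarrow> 'v pmf \<Rightarrow> (nat \<Rightarrow> 'v instr) measure" where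
  "stack_measure p D = (\<Pi>\<^sub>M j\<in>UNIV. measure_pmf (sleep_jump_pmf p D))"

lemma space_stack_measure [simp]: "space (stack_measure p D) = UNIV"
  by (simp add: stack_measure_def space_PiM)

lemma prob_space_stack_measure: "prob_space (stack_measure p D)"
  unfolding stack_measure_def by (intro prob_space_PiM measure_pmf.prob_space_axioms)

lemma measurable_stack_component [measurable]:
  "(\<lambda>\<sigma>. \<sigma> i) \<in> measurable (stack_measure p D) (count_space UNIV)"
proof -
  have "(\<lambda>\<sigma>. \<sigma> i) \<in> measurable (stack_measure p D) (measure_pmf (sleep_jump_pmf p D))"
    unfolding stack_measure_def by (rule measurable_component_singleton) simp
  then show ?thesis by (simp cong: measurable_cong_sets)
qed

lemma nn_integral_sleep_jump_pmf:
  assumes "0 \<le> p" "p \<le> 1"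
  shows "(\<integral>\<^sup>+s. f s \<partial>sleep_jump_pmf p D) = ennreal p * f Sleep + ennreal (1 - p) * (\<integral>\<^sup>+y. f (Jump y) \<partial>D)"
proof -
  have "(\<integral>\<^sup>+s. f s \<partial>sleep_jump_pmf p D) = (\<integral>\<^sup>+b. (if b then f Sleep else \<integral>\<^sup>+y. f (Jump y) \<partial>D) \<partial>bernoulli_pmf p)"
    unfolding sleep_jump_pmf_def nn_integral_bind_pmf
    by (intro nn_integral_cong) (auto simp: nn_integral_return_pmf)
  also have "\<dots> = ennreal p * f Sleep + ennreal (1 - p) * (\<integral>\<^sup>+y. f (Jump y) \<partial>D)"
    using assms by (simp add: mult.commute)
  finally show ?thesis .
qed

text \<open>
  Conditioning on the first instruction. All statements on the law of a stack follow from this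
  recursion.
\<close>

lemma nn_integral_stack_measure:
  assumes p: "0 \<le> p" "p \<le> 1" and f[measurable]: "f \<in> borel_measurable (stack_measure p D)"
  shows "(\<integral>\<^sup>+\<sigma>. f \<sigma> \<partial>stack_measure p D) =
    ennreal p * (\<integral>\<^sup>+\<sigma>. f (case_nat Sleep \<sigma>) \<partial>stack_measure p D) +
    ennreal (1 - p) * (\<integral>\<^sup>+y. \<integral>\<^sup>+\<sigma>. f (case_nat (Jump y) \<sigma>) \<partial>stack_measure p D \<partial>D)"
proof -
  let ?Q = "measure_pmf (sleep_jump_pmf p D)" and ?S = "stack_measure p D"
  interpret sequence_space ?Q by unfold_locales
  interpret prob_space ?S by (rule prob_space_stack_measure)
  have S: "?S = S" by (simp add: stack_measure_def)
  have [measurable]: "(\<lambda>(s, \<omega>). case_nat s \<omega>) \<in> measurable (?Q \<Otimes>\<^sub>M ?S) ?S"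
    unfolding S by measurable
  have "(\<integral>\<^sup>+\<sigma>. f \<sigma> \<partial>?S) = (\<integral>\<^sup>+\<sigma>. f \<sigma> \<partial>distr (?Q \<Otimes>\<^sub>M ?S) ?S (\<lambda>(s, \<omega>). case_nat s \<omega>))"
    unfolding S PiM_iter ..
  also have "\<dots> = (\<integral>\<^sup>+z. f (case z of (s, \<omega>) \<Rightarrow> case_nat s \<omega>) \<partial>(?Q \<Otimes>\<^sub>M ?S))"
    by (subst nn_integral_distr) auto
  also have "\<dots> = (\<integral>\<^sup>+s. \<integral>\<^sup>+\<sigma>. f (case_nat s \<sigma>) \<partial>?S \<partial>?Q)"
    by (subst nn_integral_fst[symmetric]) (auto simp: split_beta')
  also have "\<dots> = ennreal p * (\<integral>\<^sup>+\<sigma>. f (case_nat Sleep \<sigma>) \<partial>?S) +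
    ennreal (1 - p) * (\<integral>\<^sup>+y. \<integral>\<^sup>+\<sigma>. f (case_nat (Jump y) \<sigma>) \<partial>?S \<partial>D)"
    using p by (rule nn_integral_sleep_jump_pmf)
  finally show ?thesis .
qed

lemma ennreal_convex_fixpoint:
  fixes a b :: ennreal
  assumes "0 \<le> p" "p < 1" "a = ennreal p * a + ennreal (1 - p) * b" "a \<noteq> top" "b \<noteq> top"
  shows "a = b"
proof -
  obtain x y where xy: "a = ennreal x" "b = ennreal y" "0 \<le> x" "0 \<le> y"
    using assms by (metis ennreal_cases)
  then have "x = p * x + (1 - p) * y"
    using assms(1-3) by (simp flip: ennreal_mult'' ennreal_plus)
  then have "(1 - p) * x = (1 - p) * y" by (simp add: algebra_simps)
  with xy assms(2) show ?thesis by simp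
qed

text \<open>
  The probability \<open>q\<close> that all instructions are sleep satisfies \<open>q = p q\<close>, hence vanishes; removing
  the first instruction carries this over to all tails.
\<close>

lemma AE_recurrent:
  fixes D :: "'a pmf"
  assumes p: "0 \<le> p" "p < 1"
  shows "AE \<sigma> in stack_measure p D. recurrent \<sigma>"
proof -
  let ?S = "stack_measure p D"
  have m[measurable]: "Measurable.pred ?S (\<lambda>\<sigma>. \<forall>i\<ge>j. \<sigma> i = Sleep)" for j by measurable
  define q where "q j = (\<integral>\<^sup>+\<sigma>. indicator {\<sigma>. \<forall>i\<ge>j. \<sigma> i = Sleep} \<sigma> \<partial>?S)" for j
  have meas: "(indicator {\<sigma>. \<forall>i\<ge>j. \<sigma> i = Sleep} :: _ \<Rightarrow> ennreal) \<in> borel_measurable ?S" for j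
    using m[of j] by (intro borel_measurable_indicator) (simp add: pred_def)
  have tail: "(\<forall>i\<ge>Suc j. case_nat s \<sigma> i = Sleep) \<longleftrightarrow> (\<forall>i\<ge>j. \<sigma> i = Sleep)"
    for s and \<sigma> :: "nat \<Rightarrow> 'a instr" and j
    by (metis Suc_le_D Suc_le_mono old.nat.simps(5))
  have all: "(\<forall>i. case_nat s \<sigma> i = Sleep) \<longleftrightarrow> s = Sleep \<and> (\<forall>i. \<sigma> i = Sleep)"
    for s and \<sigma> :: "nat \<Rightarrow> 'a instr"
    by (metis old.nat.exhaust old.nat.simps(4) old.nat.simps(5))
  have "q j = 0" for j
  proof (induction j)
    case 0
    have eq: "q 0 = ennreal p * q 0 + ennreal (1 - p) * 0"
      unfolding q_def using p
      by (subst nn_integral_stack_measure[OF _ _ meas])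
         (simp_all add: indicator_def[abs_def] all)
    have ntop: "q 0 \<noteq> top"
    proof -
      interpret prob_space ?S by (rule prob_space_stack_measure)
      have "q 0 \<le> 1" unfolding q_def by (rule order_trans[OF nn_integral_mono[where v = "\<lambda>_. 1"]]) (use emeasure_space_1 in \<open>auto simp: indicator_def\<close>)
      then show ?thesis by (metis ennreal_one_less_top leD)
    qed
    show ?case by (rule ennreal_convex_fixpoint[OF p eq ntop]) simp
  next
    case (Suc j)
    have "q (Suc j) = ennreal p * q j + ennreal (1 - p) * q j"
      unfolding q_def using p
      by (subst nn_integral_stack_measure[OF _ _ meas])
         (simp_all add: indicator_def[abs_def] tail)
    with Suc show ?case by simp
  qed
  moreover have "q j = emeasure ?S {\<sigma>. \<forall>i\<ge>j. \<sigma> i = Sleep}" for j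
    unfolding q_def using m[of j] by (intro nn_integral_indicator) (simp add: pred_def)
  ultimately have "AE \<sigma> in ?S. \<not> (\<forall>i\<ge>j. \<sigma> i = Sleep)" for j
    using m[of j] by (subst AE_iff_null) (auto simp: null_sets_def pred_def)
  then show ?thesis
    by (simp add: recurrent_def AE_all_countable)
qed

lemma measurable_next_jump:
  assumes [measurable]: "j \<in> measurable (stack_measure p D) (count_space UNIV)"
  shows "(\<lambda>\<sigma>. next_jump \<sigma> (j \<sigma>)) \<in> measurable (stack_measure p D) (count_space UNIV)"
proof (rule measurable_compose_countable[where g = j and f = "\<lambda>j \<sigma>. next_jump \<sigma> j"])
  show "(\<lambda>\<sigma>. next_jump \<sigma> i) \<in> measurable (stack_measure p D) (count_space UNIV)" for i
    unfolding next_jump_def by measurable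
qed (rule assms)

lemma measurable_block_start [measurable]:
  "(\<lambda>\<sigma>. block_start \<sigma> k) \<in> measurable (stack_measure p D) (count_space UNIV)"
  by (induction k) (auto intro!: measurable_compose[OF measurable_next_jump])

lemma measurable_stack_at:
  assumes [measurable]: "j \<in> measurable (stack_measure p D) (count_space UNIV)"
  shows "(\<lambda>\<sigma>. \<sigma> (j \<sigma>)) \<in> measurable (stack_measure p D) (count_space UNIV)"
  by (rule measurable_compose_countable[where g = j and f = "\<lambda>j \<sigma>. \<sigma> j"]) measurable

lemma measurable_blocks:
  fixes D :: "'v pmf"
  assumes "countable (UNIV :: 'v set)"
  shows "blocks N \<in> measurable (stack_measure p D) (count_space UNIV)"
proof -
  have "countable ((UNIV :: bool set) \<times> (UNIV :: 'v set))"
    using assms by (intro countable_SIGMA) auto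
  then have c: "countable (UNIV :: (bool \<times> 'v) list set)"
    using countable_lists[of "UNIV :: (bool \<times> 'v) set"] by simp
  have 1: "(\<lambda>\<sigma>. \<sigma> (block_start \<sigma> k)) \<in> measurable (stack_measure p D) (count_space UNIV)" for k
    by (rule measurable_stack_at) measurable
  have 2: "(\<lambda>\<sigma>. nth_target \<sigma> k) \<in> measurable (stack_measure p D) (count_space UNIV)" for k
    unfolding nth_target_def
    by (intro measurable_compose[OF measurable_stack_at] measurable_next_jump measurable_block_start) simp
  have blk: "{\<sigma>. block \<sigma> k = b} \<in> sets (stack_measure p D)" for k b
  proof -
    have "{\<sigma>. block \<sigma> k = b} =
        ((\<lambda>\<sigma>. \<sigma> (block_start \<sigma> k)) -` (if fst b then {Sleep} else - {Sleep}) \<inter> space (stack_measure p D)) \<inter>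
        ((\<lambda>\<sigma>. nth_target \<sigma> k) -` {snd b} \<inter> space (stack_measure p D))"
      by (cases b) (auto simp: block_def sleep_set_def)
    then show ?thesis using measurable_sets[OF 1[of k]] measurable_sets[OF 2[of k]] by simp
  qed
  have "blocks N -` {ls} \<inter> space (stack_measure p D) \<in> sets (stack_measure p D)" for ls
  proof -
    have "{\<sigma> \<in> space (stack_measure p D). \<forall>k\<in>{..<N}. block \<sigma> k = ls ! k} \<in> sets (stack_measure p D)"
      by (rule sets.sets_Collect_finite_All) (use blk in auto)
    moreover have "blocks N -` {ls} \<inter> space (stack_measure p D) = (if length ls = N
        then {\<sigma> \<in> space (stack_measure p D). \<forall>k\<in>{..<N}. block \<sigma> k = ls ! k} else {})"
      by (auto simp: blocks_eq_iff)
    ultimately show ?thesis by simp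
  qed
  then show ?thesis
    by (subst measurable_count_space_eq_countable[OF c]) auto
qed

text \<open>
  Let \<open>\<Phi>\<close> be the law of the first \<open>N + 1\<close> blocks. A leading sleep instruction leaves the blocks of
  the remaining stack, with the first of them marked; a leading jump is itself an unmarked first
  block. Marking the first block twice is the same as marking it once, so the conditional law \<open>a\<close>
  after a leading sleep instruction satisfies \<open>a = p a + (1 - p) b\<close>, with \<open>b\<close> the claimed law of blocks
  whose first one is marked. Hence \<open>a = b\<close>, and the induction hypothesis gives the rest.
\<close>

lemma emeasure_blocks:
  fixes D :: "'v pmf"
  assumes c: "countable (UNIV :: 'v set)" and p: "0 \<le> p" "p < 1"
  shows "emeasure (stack_measure p D) {\<sigma>. blocks N \<sigma> \<in> X} =
    emeasure (replicate_pmf N (pair_pmf (bernoulli_pmf p) D)) X"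
proof (induction N arbitrary: X)
  case 0
  interpret prob_space "stack_measure p D" by (rule prob_space_stack_measure)
  show ?case using emeasure_space_1 by (auto simp: blocks_def indicator_def)
next
  case (Suc N)
  let ?S = "stack_measure p D" and ?R = "replicate_pmf N (pair_pmf (bernoulli_pmf p) D)"
  interpret prob_space ?S by (rule prob_space_stack_measure)
  note [measurable] = measurable_blocks[OF c]
  have sets[measurable]: "{\<sigma>. blocks N \<sigma> \<in> X} \<in> sets ?S" for N X
    using measurable_sets[OF measurable_blocks[OF c, of N p D], of X] by (simp add: vimage_def)
  define \<Phi> where "\<Phi> X = emeasure ?S {\<sigma>. blocks (Suc N) \<sigma> \<in> X}" for X
  define \<Psi> where "\<Psi> b X = (\<integral>\<^sup>+y. emeasure ?R {ls. (b, y) # ls \<in> X} \<partial>D)" for b X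
  \<comment> \<open>\<open>up X\<close> is the preimage of \<open>X\<close> under marking the first block.\<close>
  define up where "up X = {ls. (True, snd (hd ls)) # tl ls \<in> X}" for X :: "(bool \<times> 'v) list set"
  have rec: "\<Phi> X = ennreal p * \<Phi> (up X) + ennreal (1 - p) * \<Psi> False X" for X
  proof -
    have "\<Phi> X = (\<integral>\<^sup>+\<sigma>. indicator {\<sigma>. blocks (Suc N) \<sigma> \<in> X} \<sigma> \<partial>?S)"
      unfolding \<Phi>_def by simp
    also have "\<dots> = ennreal p * (\<integral>\<^sup>+\<sigma>. indicator {\<sigma>. blocks (Suc N) \<sigma> \<in> X} (case_nat Sleep \<sigma>) \<partial>?S) +
      ennreal (1 - p) * (\<integral>\<^sup>+y. \<integral>\<^sup>+\<sigma>. indicator {\<sigma>. blocks (Suc N) \<sigma> \<in> X} (case_nat (Jump y) \<sigma>) \<partial>?S \<partial>D)"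
      using p by (intro nn_integral_stack_measure) auto
    also have "(\<integral>\<^sup>+\<sigma>. indicator {\<sigma>. blocks (Suc N) \<sigma> \<in> X} (case_nat Sleep \<sigma>) \<partial>?S) =
        (\<integral>\<^sup>+\<sigma>. indicator {\<sigma>. blocks (Suc N) \<sigma> \<in> up X} \<sigma> \<partial>?S)"
      using AE_recurrent[OF p, of D]
      by (intro nn_integral_cong_AE) (auto elim!: eventually_mono simp: blocks_case_nat up_def indicator_def)
    also have "\<dots> = \<Phi> (up X)" unfolding \<Phi>_def by simp
    also have "(\<lambda>y. \<integral>\<^sup>+\<sigma>. indicator {\<sigma>. blocks (Suc N) \<sigma> \<in> X} (case_nat (Jump y) \<sigma>) \<partial>?S) =
        (\<lambda>y. emeasure ?R {ls. (False, y) # ls \<in> X})"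
    proof
      fix y
      have "(\<integral>\<^sup>+\<sigma>. indicator {\<sigma>. blocks (Suc N) \<sigma> \<in> X} (case_nat (Jump y) \<sigma>) \<partial>?S) =
          (\<integral>\<^sup>+\<sigma>. indicator {\<sigma>. blocks N \<sigma> \<in> {ls. (False, y) # ls \<in> X}} \<sigma> \<partial>?S)"
        using AE_recurrent[OF p, of D]
        by (intro nn_integral_cong_AE) (auto elim!: eventually_mono simp: blocks_case_nat indicator_def)
      then show "(\<integral>\<^sup>+\<sigma>. indicator {\<sigma>. blocks (Suc N) \<sigma> \<in> X} (case_nat (Jump y) \<sigma>) \<partial>?S) =
          emeasure ?R {ls. (False, y) # ls \<in> X}"
        by (simp only: nn_integral_indicator[OF sets] Suc.IH)
    qed
    finally show ?thesis by (simp add: \<Psi>_def)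
  qed
  have up_up: "up (up X) = up X" and \<Psi>_up: "\<Psi> False (up X) = \<Psi> True X"
    by (auto simp: up_def \<Psi>_def)
  have \<Psi>_le: "\<Psi> b X \<le> 1" for b
  proof -
    have "\<Psi> b X \<le> (\<integral>\<^sup>+y. 1 \<partial>D)" unfolding \<Psi>_def by (intro nn_integral_mono measure_pmf.emeasure_le_1)
    then show ?thesis by simp
  qed
  have "\<Phi> (up X) = \<Psi> True X"
  proof (rule ennreal_convex_fixpoint[OF p])
    show "\<Phi> (up X) = ennreal p * \<Phi> (up X) + ennreal (1 - p) * \<Psi> True X"
      using rec[of "up X"] unfolding up_up \<Psi>_up .
    show "\<Psi> True X \<noteq> top" using \<Psi>_le[of True] by (metis ennreal_one_less_top leD)
  qed (simp add: \<Phi>_def)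
  then have "\<Phi> X = ennreal p * \<Psi> True X + ennreal (1 - p) * \<Psi> False X"
    using rec[of X] by simp
  also have "\<dots> = emeasure (replicate_pmf (Suc N) (pair_pmf (bernoulli_pmf p) D)) X"
  proof -
    have "emeasure (replicate_pmf (Suc N) (pair_pmf (bernoulli_pmf p) D)) X =
        (\<integral>\<^sup>+z. emeasure ?R {ls. z # ls \<in> X} \<partial>pair_pmf (bernoulli_pmf p) D)"
      by (simp add: map_pmf_def[symmetric] vimage_def)
    also have "\<dots> = (\<integral>\<^sup>+b. \<Psi> b X \<partial>bernoulli_pmf p)"
      by (simp add: nn_integral_pair_pmf' \<Psi>_def)
    finally show ?thesis using p by (simp add: mult.commute)
  qed
  finally show ?case by (simp add: \<Phi>_def)
qed

lemma replicate_pair_pmf: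
  "replicate_pmf N (pair_pmf A B) =
     map_pmf (\<lambda>(as, bs). zip as bs) (pair_pmf (replicate_pmf N A) (replicate_pmf N B))"
proof (induction N)
  case (Suc N)
  have "replicate_pmf (Suc N) (pair_pmf A B) =
      A \<bind> (\<lambda>a. B \<bind> (\<lambda>b. replicate_pmf N A \<bind> (\<lambda>as. replicate_pmf N B \<bind> (\<lambda>bs. return_pmf ((a, b) # zip as bs)))))"
    by (simp only: replicate_pmf.simps Suc) (simp add: pair_pmf_def map_pmf_def bind_assoc_pmf bind_return_pmf)
  also have "\<dots> = A \<bind> (\<lambda>a. replicate_pmf N A \<bind> (\<lambda>as. B \<bind> (\<lambda>b. replicate_pmf N B \<bind> (\<lambda>bs. return_pmf ((a, b) # zip as bs)))))"
    by (subst bind_commute_pmf) (rule refl)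
  finally show ?case by (simp add: pair_pmf_def map_pmf_def bind_assoc_pmf bind_return_pmf)
qed (simp add: pair_return_pmf1)

lemma pair_pmf_rotate:
  "pair_pmf P (pair_pmf A B) = map_pmf (\<lambda>(y, n, b). (n, b, y)) (pair_pmf B (pair_pmf P A))"
proof -
  have "pair_pmf P (pair_pmf A B) = P \<bind> (\<lambda>n. A \<bind> (\<lambda>b. B \<bind> (\<lambda>y. return_pmf (n, b, y))))"
    by (simp add: pair_pmf_def bind_assoc_pmf bind_return_pmf)
  also have "\<dots> = P \<bind> (\<lambda>n. B \<bind> (\<lambda>y. A \<bind> (\<lambda>b. return_pmf (n, b, y))))"
    by (subst bind_commute_pmf) (rule refl)
  also have "\<dots> = B \<bind> (\<lambda>y. P \<bind> (\<lambda>n. A \<bind> (\<lambda>b. return_pmf (n, b, y))))"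
    by (rule bind_commute_pmf)
  finally show ?thesis by (simp add: pair_pmf_def map_pmf_def bind_assoc_pmf bind_return_pmf)
qed

text \<open>
  Such an event is a function of the first \<open>N\<close> blocks, and therefore measurable.
\<close>

definition prefix_determined :: "(nat \<Rightarrow> (nat \<Rightarrow> 'v) \<Rightarrow> nat set \<Rightarrow> bool) \<Rightarrow> bool" where
  "prefix_determined G \<longleftrightarrow> (\<forall>N J J' B B'. (\<forall>k<N. J' k = J k) \<longrightarrow> B' \<inter> {..<N} = B \<inter> {..<N} \<longrightarrow>
     G N J B \<longrightarrow> G N J' B')"

lemma prefix_determined_iff_blocks:
  assumes "prefix_determined G"
  shows "G N (nth_target \<sigma>) (sleep_set \<sigma>) \<longleftrightarrow>
    blocks N \<sigma> \<in> {ls. G N ((!) (map snd ls)) (true_indices (map fst ls))}"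
proof -
  have prefix: "(\<And>k. k < N \<Longrightarrow> J' k = J k) \<Longrightarrow> B' \<inter> {..<N} = B \<inter> {..<N} \<Longrightarrow> G N J B \<Longrightarrow> G N J' B'"
    for N J J' B B'
    using assms unfolding prefix_determined_def by blast
  have 1: "k < N \<Longrightarrow> snd (blocks N \<sigma> ! k) = nth_target \<sigma> k" for k
    by (simp add: blocks_def block_def)
  have 2: "true_indices (map fst (blocks N \<sigma>)) \<inter> {..<N} = sleep_set \<sigma> \<inter> {..<N}"
    by (auto simp: true_indices_def blocks_def block_def)
  show ?thesis unfolding mem_Collect_eq
    by (intro iffI; erule prefix[rotated 2]) (simp_all add: 1 2)
qed

lemma sets_prefix_determined:
  fixes D :: "'v pmf"
  assumes "countable (UNIV :: 'v set)" "prefix_determined G"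
  shows "{\<sigma>. G N (nth_target \<sigma>) (sleep_set \<sigma>)} \<in> sets (stack_measure p D)"
  using measurable_sets[OF measurable_blocks[OF assms(1), of N p D],
      of "{ls. G N ((!) (map snd ls)) (true_indices (map fst ls))}"]
  by (simp add: vimage_def prefix_determined_iff_blocks[OF assms(2)])

text \<open>
  The comparison at one vertex, with the randomness of the targets included. The events limited to
  \<open>N\<close> blocks increase to the full event; each is determined by finitely many blocks, whose targets
  can be integrated last because their law is the same for both pairs of parameters.
\<close>

lemma single_site_mono:
  fixes G :: "nat \<Rightarrow> nat \<Rightarrow> (nat \<Rightarrow> 'v) \<Rightarrow> nat set \<Rightarrow> bool" and D :: "'v pmf"
  assumes c: "countable (UNIV :: 'v set)"
    and lm: "l > 0" "m > 0" "(l', m') \<in> param_region l m" "l' > 0"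
    and event: "\<And>N J. particle_sleep_event (\<lambda>n. G n N J)"
    and prefix: "\<And>n. prefix_determined (G n)"
    and mono: "\<And>n N J B. G n N J B \<Longrightarrow> G n (Suc N) J B"
  defines "P \<equiv> \<lambda>l m. \<integral>\<^sup>+n. emeasure (stack_measure (l / (1 + l)) D)
      {\<sigma>. \<exists>N. G n N (nth_target \<sigma>) (sleep_set \<sigma>)} \<partial>poisson_pmf m"
  shows "P l m \<le> P l' m'"
proof -
  define X where "X N n = {ls. G n N ((!) (map snd ls)) (true_indices (map fst ls))}" for N n
  define A where "A N n = {\<sigma>. G n N (nth_target \<sigma>) (sleep_set \<sigma>)}" for N n
  have A_eq: "A N n = {\<sigma>. blocks N \<sigma> \<in> X N n}" for N n
    unfolding A_def X_def by (simp only: prefix_determined_iff_blocks[OF prefix])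
  let ?S = "\<lambda>l. stack_measure (l / (1 + l)) D"
  have A_sets: "A N n \<in> sets (?S l)" for N n l
    unfolding A_def by (rule sets_prefix_determined[OF c prefix])
  have A_inc: "incseq (\<lambda>N. A N n)" for n
    by (rule incseq_SucI) (auto simp: A_def intro: mono)
  have P_SUP: "P l m = (SUP N. \<integral>\<^sup>+n. emeasure (?S l) (A N n) \<partial>poisson_pmf m)" for l m
  proof -
    have "emeasure (?S l) {\<sigma>. \<exists>N. G n N (nth_target \<sigma>) (sleep_set \<sigma>)} = (SUP N. emeasure (?S l) (A N n))" for n
    proof -
      have "{\<sigma>. \<exists>N. G n N (nth_target \<sigma>) (sleep_set \<sigma>)} = (\<Union>N. A N n)" by (auto simp: A_def)
      then show ?thesis using SUP_emeasure_incseq[OF _ A_inc] A_sets by (simp add: image_subset_iff)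
    qed
    moreover have "incseq (\<lambda>N n. emeasure (?S l) (A N n))"
      using A_inc A_sets by (auto simp: incseq_def le_fun_def intro!: emeasure_mono)
    ultimately show ?thesis
      unfolding P_def by (simp add: nn_integral_monotone_convergence_SUP)
  qed
  let ?R = "\<lambda>N l. replicate_pmf N (bernoulli_pmf (l / (1 + l)))"
  let ?Q = "\<lambda>N l m. pair_pmf (poisson_pmf m) (?R N l)"
  have A_prob: "(\<integral>\<^sup>+n. emeasure (?S l) (A N n) \<partial>poisson_pmf m) =
      (\<integral>\<^sup>+ys. emeasure (?Q N l m) {(n, bs). G n N ((!) ys) (true_indices bs)} \<partial>replicate_pmf N D)"
    if "l > 0" for N l m
  proof -
    have "(\<integral>\<^sup>+n. emeasure (?S l) (A N n) \<partial>poisson_pmf m) =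
        (\<integral>\<^sup>+n. emeasure (pair_pmf (?R N l) (replicate_pmf N D)) {(bs, ys). zip bs ys \<in> X N n} \<partial>poisson_pmf m)"
      using that unfolding A_eq
      by (subst emeasure_blocks[OF c]) (auto simp: replicate_pair_pmf vimage_def split_beta')
    also have "\<dots> = emeasure (pair_pmf (poisson_pmf m) (pair_pmf (?R N l) (replicate_pmf N D)))
        {(n, bs, ys). zip bs ys \<in> X N n}"
      by (subst nn_integral_indicator[symmetric], simp, subst nn_integral_pair_pmf')
         (auto simp flip: nn_integral_indicator intro!: nn_integral_cong simp: indicator_def)
    also have "\<dots> = (\<integral>\<^sup>+ys. emeasure (?Q N l m) {(n, bs). zip bs ys \<in> X N n} \<partial>replicate_pmf N D)"
      by (subst pair_pmf_rotate, subst nn_integral_indicator[symmetric], simp, subst nn_integral_map_pmf, subst nn_integral_pair_pmf')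
         (auto simp flip: nn_integral_indicator intro!: nn_integral_cong simp: indicator_def)
    also have "\<dots> = (\<integral>\<^sup>+ys. emeasure (?Q N l m) {(n, bs). G n N ((!) ys) (true_indices bs)} \<partial>replicate_pmf N D)"
    proof (intro nn_integral_cong_AE AE_pmfI)
      fix ys assume "ys \<in> set_pmf (replicate_pmf N D)"
      then have "length ys = N" by (simp add: set_replicate_pmf)
      then show "emeasure (?Q N l m) {(n, bs). zip bs ys \<in> X N n} =
          emeasure (?Q N l m) {(n, bs). G n N ((!) ys) (true_indices bs)}"
        by (intro emeasure_eq_AE AE_pmfI) (auto simp: set_replicate_pmf X_def)
    qed
    finally show ?thesis .
  qed
  have "(\<integral>\<^sup>+n. emeasure (?S l) (A N n) \<partial>poisson_pmf m) \<le> (\<integral>\<^sup>+n. emeasure (?S l') (A N n) \<partial>poisson_pmf m')" for N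
    unfolding A_prob[OF lm(1)] A_prob[OF lm(4)] measure_pmf.emeasure_eq_measure
    by (intro nn_integral_mono ennreal_leI prob_particle_sleep_event_mono event lm)
  then show ?thesis unfolding P_SUP by (intro SUP_mono) blast
qed

section \<open>Independent fields and resampling\<close>

definition pmf_field :: "('i \<Rightarrow> 'a pmf) \<Rightarrow> ('i \<Rightarrow> 'a) measure" where
  "pmf_field P = (\<Pi>\<^sub>M i\<in>UNIV. measure_pmf (P i))"

lemma space_pmf_field [simp]: "space (pmf_field P) = UNIV"
  by (simp add: pmf_field_def space_PiM)

lemma sets_pmf_field [simp, measurable_cong]:
  "sets (pmf_field P) = sets (\<Pi>\<^sub>M i\<in>UNIV. count_space UNIV)"
  unfolding pmf_field_def by (intro sets_PiM_cong) simp_all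

lemma prob_space_pmf_field: "prob_space (pmf_field P)"
  unfolding pmf_field_def by (intro prob_space_PiM measure_pmf.prob_space_axioms)

lemma stack_measure_eq_pmf_field: "stack_measure p D = pmf_field (\<lambda>_. sleep_jump_pmf p D)"
  by (simp add: stack_measure_def pmf_field_def)

lemma measurable_override_on [measurable (raw)]:
  assumes "f \<in> measurable M (pmf_field P)" "g \<in> measurable M (pmf_field Q)"
  shows "(\<lambda>x. override_on (f x) (g x) X) \<in> measurable M (pmf_field R)"
proof -
  have [measurable]: "f \<in> measurable M (\<Pi>\<^sub>M i\<in>UNIV. count_space UNIV)"
      "g \<in> measurable M (\<Pi>\<^sub>M i\<in>UNIV. count_space UNIV)"
    using assms by (simp_all cong: measurable_cong_sets)
  have "(\<lambda>x. override_on (f x) (g x) X) \<in> measurable M (\<Pi>\<^sub>M i\<in>UNIV. count_space UNIV)"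
  proof (rule measurable_PiM_single')
    fix i
    show "(\<lambda>x. override_on (f x) (g x) X i) \<in> measurable M (count_space UNIV)"
      by (cases "i \<in> X") (simp_all add: override_on_def)
  qed auto
  then show ?thesis by (simp cong: measurable_cong_sets)
qed

text \<open>
  It suffices to compare cylinder sets, whose preimage is a product of a cylinder over the indices
  outside \<open>X\<close> and one over those inside.
\<close>

lemma distr_override_on:
  "distr (pmf_field P \<Otimes>\<^sub>M pmf_field Q) (pmf_field (override_on P Q X)) (\<lambda>(a, b). override_on a b X) =
    pmf_field (override_on P Q X)" (is "?D = ?F")
proof -
  interpret Q: prob_space "pmf_field Q" by (rule prob_space_pmf_field)
  interpret L: product_prob_space "\<lambda>i. measure_pmf (override_on P Q X i)" UNIV
    by unfold_locales
  have m: "(\<lambda>(a, b). override_on a b X) \<in> measurable (pmf_field P \<Otimes>\<^sub>M pmf_field Q) (pmf_field (override_on P Q X))"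
    by measurable
  show ?thesis
  proof (rule L.PiM_eq[folded pmf_field_def])
    fix J :: "'a set" and F :: "'a \<Rightarrow> 'b set" assume J: "finite J"
    let ?cyl = "\<lambda>R J. prod_emb UNIV (\<lambda>i. measure_pmf (R i)) J (Pi\<^sub>E J F)"
    have cyl: "?cyl R J = {\<omega>. \<forall>j\<in>J. \<omega> j \<in> F j}" for R :: "'a \<Rightarrow> 'b pmf" and J
      by (auto simp: prod_emb_def PiE_iff space_PiM)
    have cyl_sets: "finite J' \<Longrightarrow> ?cyl R J' \<in> sets (pmf_field R)" for R :: "'a \<Rightarrow> 'b pmf" and J'
      unfolding pmf_field_def by (intro sets_PiM_I) auto
    have em: "finite J' \<Longrightarrow> emeasure (pmf_field R) (?cyl R J') = (\<Prod>j\<in>J'. emeasure (R j) (F j))"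
      for R :: "'a \<Rightarrow> 'b pmf" and J'
      unfolding pmf_field_def by (intro emeasure_PiM_emb) (auto intro: measure_pmf.prob_space_axioms)
    have "emeasure ?D (?cyl (override_on P Q X) J) =
       emeasure (pmf_field P \<Otimes>\<^sub>M pmf_field Q) (?cyl P (J - X) \<times> ?cyl Q (J \<inter> X))"
      unfolding emeasure_distr[OF m cyl_sets[OF J]]
      by (auto simp: cyl space_pair_measure override_on_def
           intro!: arg_cong[where f = "emeasure _"] split: if_splits)
    also have "\<dots> = (\<Prod>j\<in>J - X. emeasure (P j) (F j)) * (\<Prod>j\<in>J \<inter> X. emeasure (Q j) (F j))"
      using J cyl_sets by (subst Q.emeasure_pair_measure_Times) (auto simp: em)
    also have "\<dots> = (\<Prod>j\<in>J. emeasure (override_on P Q X j) (F j))"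
      unfolding prod.Int_Diff[OF J, of _ X] mult.commute[of "prod _ (J - X)"]
      by (intro arg_cong2[where f = "(*)"] prod.cong) (auto simp: override_on_def)
    finally show "emeasure ?D (?cyl (override_on P Q X) J) =
         (\<Prod>j\<in>J. emeasure (override_on P Q X j) (F j))" .
  qed simp
qed

lemma nn_integral_override_on:
  assumes f: "f \<in> borel_measurable (pmf_field (override_on P Q X))"
  shows "(\<integral>\<^sup>+\<omega>. f \<omega> \<partial>pmf_field (override_on P Q X)) =
    (\<integral>\<^sup>+a. \<integral>\<^sup>+b. f (override_on a b X) \<partial>pmf_field Q \<partial>pmf_field P)"
proof -
  interpret Q: prob_space "pmf_field Q" by (rule prob_space_pmf_field)
  note [measurable] = f
  have "(\<integral>\<^sup>+\<omega>. f \<omega> \<partial>pmf_field (override_on P Q X)) =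
      (\<integral>\<^sup>+z. f (case z of (a, b) \<Rightarrow> override_on a b X) \<partial>(pmf_field P \<Otimes>\<^sub>M pmf_field Q))"
    by (subst distr_override_on[symmetric], subst nn_integral_distr) simp_all
  also have "\<dots> = (\<integral>\<^sup>+a. \<integral>\<^sup>+b. f (override_on a b X) \<partial>pmf_field Q \<partial>pmf_field P)"
    by (subst Q.nn_integral_fst[symmetric]) (simp_all add: split_beta')
  finally show ?thesis .
qed

text \<open>
  The same for a pair of independent fields, with the two resampled fields as the inner integrals, so
  that integrands can be compared for a fixed outside configuration.
\<close>

lemma emeasure_pair_override_on:
  fixes P Q :: "'i \<Rightarrow> 'a pmf" and P' Q' :: "'j \<Rightarrow> 'b pmf"
  assumes A: "A \<in> sets ((\<Pi>\<^sub>M i\<in>UNIV. count_space UNIV) \<Otimes>\<^sub>M (\<Pi>\<^sub>M j\<in>UNIV. count_space UNIV))"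
  shows "emeasure (pmf_field (override_on P Q X) \<Otimes>\<^sub>M pmf_field (override_on P' Q' X')) A =
    (\<integral>\<^sup>+\<eta>. \<integral>\<^sup>+\<tau>. \<integral>\<^sup>+\<eta>'. \<integral>\<^sup>+\<tau>'. indicator A (override_on \<eta> \<eta>' X, override_on \<tau> \<tau>' X')
      \<partial>pmf_field Q' \<partial>pmf_field Q \<partial>pmf_field P' \<partial>pmf_field P)"
proof -
  interpret Q: prob_space "pmf_field Q" by (rule prob_space_pmf_field)
  interpret P': prob_space "pmf_field P'" by (rule prob_space_pmf_field)
  interpret Q': prob_space "pmf_field Q'" by (rule prob_space_pmf_field)
  interpret M: prob_space "pmf_field (override_on P' Q' X')" by (rule prob_space_pmf_field)
  interpret PQ: pair_sigma_finite "pmf_field Q" "pmf_field P'" by unfold_locales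
  note [measurable] = A
  have [measurable]: "A \<in> sets (pmf_field R \<Otimes>\<^sub>M pmf_field R')" for R R'
    using A by (simp cong: sets_pair_measure_cong)
  have "emeasure (pmf_field (override_on P Q X) \<Otimes>\<^sub>M pmf_field (override_on P' Q' X')) A =
     (\<integral>\<^sup>+\<eta>. \<integral>\<^sup>+\<tau>. indicator A (\<eta>, \<tau>) \<partial>pmf_field (override_on P' Q' X') \<partial>pmf_field (override_on P Q X))"
    by (rule M.emeasure_pair_measure) simp
  also have "\<dots> = (\<integral>\<^sup>+\<eta>. \<integral>\<^sup>+\<eta>'. \<integral>\<^sup>+\<tau>. indicator A (override_on \<eta> \<eta>' X, \<tau>)
      \<partial>pmf_field (override_on P' Q' X') \<partial>pmf_field Q \<partial>pmf_field P)"
    by (rule nn_integral_override_on) measurable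
  also have "\<dots> = (\<integral>\<^sup>+\<eta>. \<integral>\<^sup>+\<eta>'. \<integral>\<^sup>+\<tau>. \<integral>\<^sup>+\<tau>'. indicator A (override_on \<eta> \<eta>' X, override_on \<tau> \<tau>' X')
      \<partial>pmf_field Q' \<partial>pmf_field P' \<partial>pmf_field Q \<partial>pmf_field P)"
    by (intro nn_integral_cong nn_integral_override_on) measurable
  also have "\<dots> = (\<integral>\<^sup>+\<eta>. \<integral>\<^sup>+\<tau>. \<integral>\<^sup>+\<eta>'. \<integral>\<^sup>+\<tau>'. indicator A (override_on \<eta> \<eta>' X, override_on \<tau> \<tau>' X')
      \<partial>pmf_field Q' \<partial>pmf_field Q \<partial>pmf_field P' \<partial>pmf_field P)"
    by (intro nn_integral_cong PQ.Fubini'[symmetric]) measurable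
  finally show ?thesis .
qed

lemma distr_pmf_field_reindex:
  assumes "inj f"
  shows "distr (pmf_field P) (pmf_field (\<lambda>i. P (f i))) (\<lambda>\<omega> i. \<omega> (f i)) = pmf_field (\<lambda>i. P (f i))"
  using distr_PiM_reindex[of UNIV "\<lambda>i. measure_pmf (P i)" f UNIV] assms
  by (simp add: pmf_field_def measure_pmf.prob_space_axioms restrict_def)

lemma AE_pmf_field:
  fixes P :: "'i \<Rightarrow> 'a pmf"
  assumes "countable (UNIV :: 'i set)" "\<And>i. AE s in measure_pmf (P i). R i s"
  shows "AE \<omega> in pmf_field P. \<forall>i :: 'i. R i (\<omega> i)"
proof -
  have "AE \<omega> in pmf_field P. R i (\<omega> i)" for i
    unfolding pmf_field_def
    by (rule AE_PiM_component) (auto intro: measure_pmf.prob_space_axioms assms(2))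
  then have "AE \<omega> in pmf_field P. \<forall>i\<in>UNIV. R i (\<omega> i)"
    using assms(1) by (subst AE_ball_countable) auto
  then show ?thesis by simp
qed

section \<open>The event seen from one vertex\<close>

text \<open>
  The event as a function of the particle number \<open>n\<close>, the targets \<open>J'\<close> and the sleep marks \<open>B\<close> at \<open>x\<close>,
  the values of \<open>c\<close>, \<open>J\<close> and \<open>Z\<close> at \<open>x\<close> being overwritten. The bound \<open>N\<close> on the number of jumps at \<open>x\<close>
  makes it depend on finitely many blocks.
\<close>

definition site_event ::
  "'v set \<Rightarrow> ('v \<Rightarrow> nat) \<Rightarrow> ('v \<Rightarrow> nat \<Rightarrow> 'v) \<Rightarrow> ('v \<Rightarrow> nat set) \<Rightarrow> ('v \<Rightarrow> nat) \<Rightarrow> 'v \<Rightarrow>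
     nat \<Rightarrow> nat \<Rightarrow> (nat \<Rightarrow> 'v) \<Rightarrow> nat set \<Rightarrow> bool" where
  "site_event K c J Z H x n N J' B \<longleftrightarrow>
    (\<exists>u. reachable K (c(x := n)) (J(x := J')) (Z(x := B)) u \<and> (\<forall>y\<in>K. H y \<le> u y) \<and> u x \<le> N)"

lemma site_event_Suc: "site_event K c J Z H x n N J' B \<Longrightarrow> site_event K c J Z H x n (Suc N) J' B"
  unfolding site_event_def using le_SucI by blast

lemma ex_site_event_iff:
  "(\<exists>N. site_event K c J Z H x n N J' B) \<longleftrightarrow>
    (\<exists>u. reachable K (c(x := n)) (J(x := J')) (Z(x := B)) u \<and> (\<forall>y\<in>K. H y \<le> u y))"
  unfolding site_event_def by blast

lemma particle_sleep_event_site_event: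
  fixes H :: "'v \<Rightarrow> nat"
  assumes K: "finite K"
  shows "particle_sleep_event (\<lambda>n. site_event K c J Z H x n N J')"
  unfolding particle_sleep_event_def
proof (intro conjI allI impI)
  fix n B B' assume "B' \<subseteq> B" "site_event K c J Z H x n N J' B"
  then obtain u where u: "reachable K (c(x := n)) (J(x := J')) (Z(x := B)) u"
    "\<forall>y\<in>K. H y \<le> u y" "u x \<le> N" by (auto simp: site_event_def)
  have "reachable K (c(x := n)) (J(x := J')) (Z(x := B')) u"
    by (rule reachable_mono[OF u(1)]) (use \<open>B' \<subseteq> B\<close> in auto)
  with u show "site_event K c J Z H x n N J' B'" by (auto simp: site_event_def)
next
  fix n B assume "site_event K c J Z H x n N J' {}"
  then obtain u where u: "reachable K (c(x := n)) (J(x := J')) (Z(x := {})) u"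
    "\<forall>y\<in>K. H y \<le> u y" "u x \<le> N" by (auto simp: site_event_def)
  from reachable_add_particle[OF u(1), of B]
  have "reachable K (c(x := Suc n)) (J(x := J')) (Z(x := B)) u" by simp
  with u show "site_event K c J Z H x (Suc n) N J' B" by (auto simp: site_event_def)
next
  fix n B B' assume "site_event K c J Z H x n N J' B" "site_event K c J Z H x n N J' B'"
  then obtain u u' where u: "reachable K (c(x := n)) (J(x := J')) (Z(x := B)) u"
      "\<forall>y\<in>K. H y \<le> u y" "u x \<le> N"
    and u': "reachable K (c(x := n)) (J(x := J')) (Z(x := B')) u'"
      "\<forall>y\<in>K. H y \<le> u' y" "u' x \<le> N" by (auto simp: site_event_def)
  obtain w where w: "reachable K (c(x := n)) (J(x := J')) (Z(x := B \<union> B')) w"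
    "u \<le> w \<or> u' \<le> w" "w \<le> sup u u'"
    by (rule reachable_Un_sleeps[OF K u(1) u'(1)])
  have "w x \<le> N" using le_funD[OF w(3), of x] u(3) u'(3) by (simp add: sup_nat_def)
  moreover have "\<forall>y\<in>K. H y \<le> w y"
    using w(2) u(2) u'(2) by (meson le_funD order_trans)
  ultimately show "site_event K c J Z H x n N J' (B \<union> B')"
    using w(1) by (auto simp: site_event_def)
qed

lemma prefix_determined_site_event:
  "prefix_determined (site_event K c J Z H x n)"
  unfolding prefix_determined_def
proof (intro allI impI)
  fix N J1 J2 B1 B2
  assume J: "\<forall>k<N. J2 k = J1 k" and B: "B2 \<inter> {..<N} = B1 \<inter> {..<N}"
    and "site_event K c J Z H x n N J1 B1"
  then obtain u where u: "reachable K (c(x := n)) (J(x := J1)) (Z(x := B1)) u"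
    "\<forall>y\<in>K. H y \<le> u y" "u x \<le> N" by (auto simp: site_event_def)
  have "k \<in> B2 \<longleftrightarrow> k \<in> B1" if "k < N" for k using B that by auto
  then have "reachable K (c(x := n)) (J(x := J2)) (Z(x := B2)) u"
    using J u(3) by (intro reachable_cong_prefix[OF u(1)]) auto
  with u show "site_event K c J Z H x n N J2 B2" by (auto simp: site_event_def)
qed

section \<open>Changing the parameters vertex by vertex\<close>

text \<open>
  Parameters that vary from vertex to vertex interpolate between the two homogeneous models.
\<close>

definition site_measure :: "'v set set \<Rightarrow> ('v \<Rightarrow> real) \<Rightarrow> ('v \<Rightarrow> real) \<Rightarrow> ('v config \<times> 'v array) measure" where
  "site_measure E l m = pmf_field (\<lambda>x. map_pmf Active (poisson_pmf (m x))) \<Otimes>\<^sub>M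
     pmf_field (\<lambda>p. instr_pmf E (l (fst p)) (fst p))"

lemma arw_measure_eq_site_measure: "arw_measure E l m = site_measure E (\<lambda>_. l) (\<lambda>_. m)"
  by (simp add: arw_measure_def site_measure_def pmf_field_def)

lemma instr_pmf_eq: "instr_pmf E l x = sleep_jump_pmf (l / (1 + l)) (pmf_of_set (nbrs E x))"
  by (simp add: instr_pmf_def sleep_jump_pmf_def)

lemma countable_vertices:
  assumes "connected_graph (E :: 'v set set)" "locally_finite E"
  shows "countable (UNIV :: 'v set)"
proof -
  fix x :: 'v
  let ?R = "{(x, y). adj E x y}"
  have "countable (?R `` Y)" if "countable Y" for Y
  proof -
    have "?R `` Y = (\<Union>y\<in>Y. nbrs E y)" by (auto simp: nbrs_def)
    moreover have "countable (\<Union>y\<in>Y. nbrs E y)"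
      using that assms(2) by (intro countable_UN) (auto simp: locally_finite_def intro: countable_finite)
    ultimately show ?thesis by metis
  qed
  then have "countable (?R\<^sup>* `` {x})" by (intro countable_rtrancl) auto
  moreover have "?R\<^sup>* `` {x} = UNIV"
    using assms(1) by (auto simp: connected_graph_def rtrancl_def)
  ultimately show ?thesis by simp
qed

lemma nbrs_nonempty:
  assumes "infinite (UNIV :: 'v set)" "connected_graph (E :: 'v set set)"
  shows "nbrs E x \<noteq> {}"
proof -
  have "UNIV \<noteq> {x}" using assms(1) by (metis finite.emptyI finite.insertI)
  then obtain y where "y \<noteq> x" by blast
  moreover have "(adj E)\<^sup>*\<^sup>* x y" using assms(2) by (simp add: connected_graph_def)
  ultimately obtain z where "adj E x z" by (metis converse_rtranclpE)
  then show ?thesis by (auto simp: nbrs_def)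
qed

text \<open>
  The almost sure properties of an array under which the event has its block description.
\<close>

definition regular_array :: "'v set set \<Rightarrow> 'v array \<Rightarrow> bool" where
  "regular_array E \<tau> \<longleftrightarrow> \<tau> \<in> arrays E \<and> (\<forall>x. recurrent (stack \<tau> x))"

definition all_active :: "'v config \<Rightarrow> bool" where
  "all_active \<eta> \<longleftrightarrow> (\<forall>x. \<exists>n. \<eta> x = Active n)"

lemma AE_all_active:
  assumes "countable (UNIV :: 'v set)"
  shows "AE \<eta> in pmf_field (\<lambda>x :: 'v. map_pmf Active (poisson_pmf (m x))). all_active \<eta>"
  unfolding all_active_def
  by (rule AE_pmf_field[OF assms]) (auto simp: AE_measure_pmf_iff)

lemma distr_stack:
  "distr (pmf_field (\<lambda>p. instr_pmf E (l (fst p)) (fst p)))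
     (stack_measure (l x / (1 + l x)) (pmf_of_set (nbrs E x))) (\<lambda>\<tau>. stack \<tau> x) =
   stack_measure (l x / (1 + l x)) (pmf_of_set (nbrs E x))"
  using distr_pmf_field_reindex[of "Pair x" "\<lambda>p. instr_pmf E (l (fst p)) (fst p)"]
  by (simp add: stack_measure_eq_pmf_field instr_pmf_eq stack_def inj_on_def)

lemma measurable_stack:
  "(\<lambda>\<tau>. stack \<tau> x) \<in> measurable (pmf_field P) (stack_measure p D)"
proof -
  have "(\<lambda>\<tau>. stack \<tau> x) \<in> measurable (\<Pi>\<^sub>M p\<in>UNIV. count_space UNIV) (\<Pi>\<^sub>M j\<in>UNIV. count_space UNIV)"
    unfolding stack_def by (rule measurable_PiM_single') (auto intro: measurable_component_singleton)
  then show ?thesis by (simp add: stack_measure_eq_pmf_field cong: measurable_cong_sets)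
qed

lemma AE_regular_array:
  assumes graph: "infinite (UNIV :: 'v set)" "connected_graph (E :: 'v set set)" "locally_finite E"
    and l: "\<And>x. l x > 0"
  shows "AE \<tau> in pmf_field (\<lambda>p. instr_pmf E (l (fst p)) (fst p)). regular_array E \<tau>"
proof -
  have c: "countable (UNIV :: 'v set)" by (rule countable_vertices) fact+
  have c': "countable (UNIV :: ('v \<times> nat) set)"
    using countable_SIGMA[OF c, of "\<lambda>_. UNIV :: nat set"] by simp
  let ?T = "pmf_field (\<lambda>p :: 'v \<times> nat. instr_pmf E (l (fst p)) (fst p))"
  have "AE \<tau> in ?T. \<forall>p. \<tau> p \<in> instrs_at E (fst p)"
  proof (rule AE_pmf_field[OF c', where R = "\<lambda>p s. s \<in> instrs_at E (fst p)"])
    fix p :: "'v \<times> nat"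
    have "set_pmf (pmf_of_set (nbrs E (fst p))) = nbrs E (fst p)"
      using graph nbrs_nonempty[of E] by (intro set_pmf_of_set) (auto simp: locally_finite_def)
    then show "AE s in measure_pmf (instr_pmf E (l (fst p)) (fst p)). s \<in> instrs_at E (fst p)"
      by (auto simp: AE_measure_pmf_iff instr_pmf_def instrs_at_def split: if_splits)
  qed
  moreover have "AE \<tau> in ?T. \<forall>x. recurrent (stack \<tau> x)"
  proof -
    have "AE \<tau> in ?T. recurrent (stack \<tau> x)" for x
    proof (rule AE_distrD[where f = "\<lambda>\<tau>. stack \<tau> x"])
      show "AE \<sigma> in distr ?T (stack_measure (l x / (1 + l x)) (pmf_of_set (nbrs E x))) (\<lambda>\<tau>. stack \<tau> x). recurrent \<sigma>"
        unfolding distr_stack using l[of x] by (intro AE_recurrent) (auto simp: field_simps)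
    qed (rule measurable_stack)
    then have "AE \<tau> in ?T. \<forall>x\<in>UNIV. recurrent (stack \<tau> x)"
      using c by (subst AE_ball_countable) auto
    then show ?thesis by simp
  qed
  ultimately show ?thesis
    by eventually_elim (auto simp: regular_array_def arrays_def)
qed

lemma stack_override_on:
  "stack (override_on \<tau> \<tau>' (X \<times> UNIV)) x = (if x \<in> X then stack \<tau>' x else stack \<tau> x)"
  by (auto simp: stack_def override_on_def)

lemma regular_array_override_on:
  "regular_array E \<tau> \<Longrightarrow> regular_array E \<tau>' \<Longrightarrow> regular_array E (override_on \<tau> \<tau>' (X \<times> UNIV))"
  by (auto simp: regular_array_def arrays_def override_on_def stack_override_on[unfolded override_on_def])

context
  fixes E :: "'v set set" and A :: "('v config \<times> 'v array) set" and K :: "'v set" and H :: "'v \<Rightarrow> nat"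
  assumes graph: "infinite (UNIV :: 'v set)" "connected_graph E" "locally_finite E"
    and A_sets: "A \<in> sets arw_space" and K: "finite K"
    and A_def: "A = {(\<eta>, \<tau>). \<tau> \<in> arrays E \<and> (\<forall>x\<in>K. jump_odometer K \<eta> \<tau> x \<ge> enat (H x))}"
begin

lemma mem_event_iff:
  assumes "all_active \<eta>" "regular_array E \<tau>"
  shows "(\<eta>, \<tau>) \<in> A \<longleftrightarrow>
    (\<exists>u. reachable K (\<lambda>y. site_count (\<eta> y)) (targets \<tau>) (sleeps \<tau>) u \<and> (\<forall>y\<in>K. H y \<le> u y))"
proof -
  have "\<eta> = (\<lambda>y. Active (site_count (\<eta> y)))"
    using assms(1) by (auto simp: all_active_def fun_eq_iff) (metis site_count.simps(1))
  then have "jump_odometer K \<eta> \<tau> = jump_odometer K (\<lambda>y. Active (site_count (\<eta> y))) \<tau>" by simp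
  then show ?thesis
    using assms(2) jump_odometer_iff_reachable[OF K, of \<tau> H "\<lambda>y. site_count (\<eta> y)"]
    by (simp add: A_def regular_array_def)
qed

lemma emeasure_site_measure_override_on:
  "emeasure (site_measure E (override_on l l' X) (override_on m m' X)) A =
    (\<integral>\<^sup>+\<eta>. \<integral>\<^sup>+\<tau>. \<integral>\<^sup>+\<eta>'. \<integral>\<^sup>+\<tau>'. indicator A (override_on \<eta> \<eta>' X, override_on \<tau> \<tau>' (X \<times> UNIV))
      \<partial>pmf_field (\<lambda>p. instr_pmf E (l' (fst p)) (fst p)) \<partial>pmf_field (\<lambda>x. map_pmf Active (poisson_pmf (m' x)))
      \<partial>pmf_field (\<lambda>p. instr_pmf E (l (fst p)) (fst p)) \<partial>pmf_field (\<lambda>x. map_pmf Active (poisson_pmf (m x))))"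
proof -
  have "(\<lambda>x. map_pmf Active (poisson_pmf (override_on m m' X x))) =
      override_on (\<lambda>x. map_pmf Active (poisson_pmf (m x))) (\<lambda>x. map_pmf Active (poisson_pmf (m' x))) X"
    by (auto simp: override_on_def)
  moreover have "(\<lambda>p :: 'v \<times> nat. instr_pmf E (override_on l l' X (fst p)) (fst p)) =
      override_on (\<lambda>p. instr_pmf E (l (fst p)) (fst p)) (\<lambda>p. instr_pmf E (l' (fst p)) (fst p)) (X \<times> UNIV)"
    by (auto simp: override_on_def)
  ultimately show ?thesis
    unfolding site_measure_def using A_sets[unfolded arw_space_def]
    by (simp only: emeasure_pair_override_on)
qed

text \<open>
  The new values at \<open>x\<close> are almost surely regular, so the event has its block description, which
  depends on the new fields only through the particle number and the stack at \<open>x\<close>.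
\<close>

lemma emeasure_single_site_resampled:
  assumes \<eta>: "all_active \<eta>" and \<tau>: "regular_array E \<tau>" and l: "\<And>y. l y > 0"
  shows "(\<integral>\<^sup>+\<eta>'. \<integral>\<^sup>+\<tau>'. indicator A (override_on \<eta> \<eta>' {x}, override_on \<tau> \<tau>' ({x} \<times> UNIV))
      \<partial>pmf_field (\<lambda>p. instr_pmf E (l (fst p)) (fst p)) \<partial>pmf_field (\<lambda>x. map_pmf Active (poisson_pmf (m x)))) =
    (\<integral>\<^sup>+n. emeasure (stack_measure (l x / (1 + l x)) (pmf_of_set (nbrs E x)))
      {\<sigma>. \<exists>N. site_event K (\<lambda>y. site_count (\<eta> y)) (targets \<tau>) (sleeps \<tau>) H x n N (nth_target \<sigma>) (sleep_set \<sigma>)}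
      \<partial>poisson_pmf (m x))"
proof -
  let ?C = "pmf_field (\<lambda>x. map_pmf Active (poisson_pmf (m x)))"
  let ?T = "pmf_field (\<lambda>p :: 'v \<times> nat. instr_pmf E (l (fst p)) (fst p))"
  let ?S = "stack_measure (l x / (1 + l x)) (pmf_of_set (nbrs E x))"
  define Y where "Y n = {\<sigma>. \<exists>N. site_event K (\<lambda>y. site_count (\<eta> y)) (targets \<tau>) (sleeps \<tau>) H x n N
    (nth_target \<sigma>) (sleep_set \<sigma>)}" for n
  have c: "countable (UNIV :: 'v set)" using graph by (intro countable_vertices)
  have Y_sets: "Y n \<in> sets ?S" for n
  proof -
    have "Y n = (\<Union>N. {\<sigma>. site_event K (\<lambda>y. site_count (\<eta> y)) (targets \<tau>) (sleeps \<tau>) H x n N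
      (nth_target \<sigma>) (sleep_set \<sigma>)})" by (auto simp: Y_def)
    then show ?thesis using sets_prefix_determined[OF c prefix_determined_site_event] by auto
  qed
  have "indicator A (override_on \<eta> \<eta>' {x}, override_on \<tau> \<tau>' ({x} \<times> UNIV)) =
      (indicator (Y (site_count (\<eta>' x))) (stack \<tau>' x) :: ennreal)"
    if "all_active \<eta>'" "regular_array E \<tau>'" for \<eta>' \<tau>'
  proof -
    have act: "all_active (override_on \<eta> \<eta>' {x})"
      using \<eta> that(1) by (auto simp: all_active_def override_on_def)
    have 1: "(\<lambda>y. site_count (override_on \<eta> \<eta>' {x} y)) = (\<lambda>y. site_count (\<eta> y))(x := site_count (\<eta>' x))"
      "targets (override_on \<tau> \<tau>' ({x} \<times> UNIV)) = (targets \<tau>)(x := nth_target (stack \<tau>' x))"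
      "sleeps (override_on \<tau> \<tau>' ({x} \<times> UNIV)) = (sleeps \<tau>)(x := sleep_set (stack \<tau>' x))"
      by (simp_all add: fun_eq_iff stack_override_on)
    show ?thesis
      unfolding indicator_def mem_event_iff[OF act regular_array_override_on[OF \<tau> that(2)]] 1
      by (simp add: Y_def ex_site_event_iff)
  qed
  then have "(\<integral>\<^sup>+\<eta>'. \<integral>\<^sup>+\<tau>'. indicator A (override_on \<eta> \<eta>' {x}, override_on \<tau> \<tau>' ({x} \<times> UNIV)) \<partial>?T \<partial>?C) =
      (\<integral>\<^sup>+\<eta>'. \<integral>\<^sup>+\<tau>'. indicator (Y (site_count (\<eta>' x))) (stack \<tau>' x) \<partial>?T \<partial>?C)"
    using AE_all_active[OF c, of m] AE_regular_array[OF graph, of l] l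
    by (intro nn_integral_cong_AE) (auto elim!: eventually_mono intro!: nn_integral_cong_AE)
  also have "\<dots> = (\<integral>\<^sup>+\<eta>'. emeasure ?S (Y (site_count (\<eta>' x))) \<partial>?C)"
  proof (rule nn_integral_cong)
    fix \<eta>' :: "'v config"
    have "emeasure ?S (Y (site_count (\<eta>' x))) = (\<integral>\<^sup>+\<sigma>. indicator (Y (site_count (\<eta>' x))) \<sigma> \<partial>?S)"
      using Y_sets by simp
    also have "\<dots> = (\<integral>\<^sup>+\<sigma>. indicator (Y (site_count (\<eta>' x))) \<sigma> \<partial>distr ?T ?S (\<lambda>\<tau>. stack \<tau> x))"
      unfolding distr_stack ..
    also have "\<dots> = (\<integral>\<^sup>+\<tau>'. indicator (Y (site_count (\<eta>' x))) (stack \<tau>' x) \<partial>?T)"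
      using Y_sets by (intro nn_integral_distr measurable_stack borel_measurable_indicator) simp
    finally show "(\<integral>\<^sup>+\<tau>'. indicator (Y (site_count (\<eta>' x))) (stack \<tau>' x) \<partial>?T) = emeasure ?S (Y (site_count (\<eta>' x)))" ..
  qed
  also have "\<dots> = (\<integral>\<^sup>+s. emeasure ?S (Y (site_count s)) \<partial>map_pmf Active (poisson_pmf (m x)))"
  proof -
    have comp: "distr ?C (measure_pmf (map_pmf Active (poisson_pmf (m x)))) (\<lambda>\<eta>. \<eta> x) =
        measure_pmf (map_pmf Active (poisson_pmf (m x)))"
      unfolding pmf_field_def
      by (rule distr_PiM_component) (auto intro: measure_pmf.prob_space_axioms)
    have "(\<lambda>\<eta>. \<eta> x) \<in> measurable ?C (measure_pmf (map_pmf Active (poisson_pmf (m x))))"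
      unfolding pmf_field_def by (rule measurable_component_singleton) simp
    then show ?thesis by (subst comp[symmetric], subst nn_integral_distr) simp_all
  qed
  also have "\<dots> = (\<integral>\<^sup>+n. emeasure ?S (Y n) \<partial>poisson_pmf (m x))" by simp
  finally show ?thesis by (simp add: Y_def)
qed

text \<open>
  Both measures are written as resamplings at \<open>x\<close> of the same field, so that the one-vertex
  comparison applies for almost every outside.
\<close>

lemma emeasure_update_site_mono:
  assumes l: "\<And>y. l y > 0" and m: "m x > 0"
    and region: "(l', m') \<in> param_region (l x) (m x)" "l' > 0"
  shows "emeasure (site_measure E l m) A \<le> emeasure (site_measure E (l(x := l')) (m(x := m'))) A"
proof -
  have upd: "l(x := l') = override_on l (\<lambda>_. l') {x}" "m(x := m') = override_on m (\<lambda>_. m') {x}"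
    by (auto simp: override_on_def)
  have c: "countable (UNIV :: 'v set)" using graph by (intro countable_vertices)
  \<comment> \<open>Overriding with the old parameters changes nothing, but puts the left side into resampled form.\<close>
  have "emeasure (site_measure E (override_on l l {x}) (override_on m m {x})) A \<le>
      emeasure (site_measure E (override_on l (\<lambda>_. l') {x}) (override_on m (\<lambda>_. m') {x})) A"
    unfolding emeasure_site_measure_override_on
  proof (rule nn_integral_mono_AE, rule AE_mp[OF AE_all_active[OF c]], rule AE_I2, rule impI)
    fix \<eta> :: "'v config" assume \<eta>: "all_active \<eta>"
    show "(\<integral>\<^sup>+\<tau>. \<integral>\<^sup>+\<eta>'. \<integral>\<^sup>+\<tau>'. indicator A (override_on \<eta> \<eta>' {x}, override_on \<tau> \<tau>' ({x} \<times> UNIV))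
          \<partial>pmf_field (\<lambda>p. instr_pmf E (l (fst p)) (fst p)) \<partial>pmf_field (\<lambda>x. map_pmf Active (poisson_pmf (m x)))
          \<partial>pmf_field (\<lambda>p. instr_pmf E (l (fst p)) (fst p))) \<le>
        (\<integral>\<^sup>+\<tau>. \<integral>\<^sup>+\<eta>'. \<integral>\<^sup>+\<tau>'. indicator A (override_on \<eta> \<eta>' {x}, override_on \<tau> \<tau>' ({x} \<times> UNIV))
          \<partial>pmf_field (\<lambda>p. instr_pmf E l' (fst p)) \<partial>pmf_field (\<lambda>x. map_pmf Active (poisson_pmf m'))
          \<partial>pmf_field (\<lambda>p. instr_pmf E (l (fst p)) (fst p)))"
    proof (rule nn_integral_mono_AE, rule AE_mp[OF AE_regular_array[OF graph l]], rule AE_I2, rule impI)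
      fix \<tau> :: "'v array" assume \<tau>: "regular_array E \<tau>"
      note resampled = emeasure_single_site_resampled[OF \<eta> \<tau>]
      show "(\<integral>\<^sup>+\<eta>'. \<integral>\<^sup>+\<tau>'. indicator A (override_on \<eta> \<eta>' {x}, override_on \<tau> \<tau>' ({x} \<times> UNIV))
          \<partial>pmf_field (\<lambda>p. instr_pmf E (l (fst p)) (fst p)) \<partial>pmf_field (\<lambda>x. map_pmf Active (poisson_pmf (m x)))) \<le>
        (\<integral>\<^sup>+\<eta>'. \<integral>\<^sup>+\<tau>'. indicator A (override_on \<eta> \<eta>' {x}, override_on \<tau> \<tau>' ({x} \<times> UNIV))
          \<partial>pmf_field (\<lambda>p. instr_pmf E l' (fst p)) \<partial>pmf_field (\<lambda>x. map_pmf Active (poisson_pmf m')))"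
        unfolding resampled[where l = l and m = m, OF l]
          resampled[where l = "\<lambda>_. l'" and m = "\<lambda>_. m'", OF region(2)]
        by (rule single_site_mono[OF c l m region])
           (auto intro: particle_sleep_event_site_event[OF K] prefix_determined_site_event site_event_Suc)
    qed
  qed
  moreover have "override_on l l {x} = l" "override_on m m {x} = m"
    by (auto simp: override_on_def)
  ultimately show ?thesis by (simp add: upd)
qed

lemma emeasure_update_sites_mono:
  assumes lm: "l > 0" "m > 0" "(l', m') \<in> param_region l m" "l' > 0" and X: "finite X"
  shows "emeasure (site_measure E (\<lambda>_. l) (\<lambda>_. m)) A \<le>
    emeasure (site_measure E (override_on (\<lambda>_. l) (\<lambda>_. l') X) (override_on (\<lambda>_. m) (\<lambda>_. m') X)) A"
  using X
proof (induction X)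
  case (insert x X)
  let ?l = "override_on (\<lambda>_. l) (\<lambda>_. l') X" and ?m = "override_on (\<lambda>_. m) (\<lambda>_. m') X"
  have upd: "override_on (\<lambda>_. l) (\<lambda>_. l') (insert x X) = ?l(x := l')"
    "override_on (\<lambda>_. m) (\<lambda>_. m') (insert x X) = ?m(x := m')"
    by (auto simp: override_on_def)
  have "emeasure (site_measure E ?l ?m) A \<le> emeasure (site_measure E (?l(x := l')) (?m(x := m'))) A"
    using lm insert.hyps by (intro emeasure_update_site_mono) (auto simp: override_on_def)
  with insert.IH show ?case unfolding upd by (rule order_trans)
qed (simp add: override_on_def)

text \<open>
  Runs inside \<open>K\<close> use neither particles nor instructions of vertices outside \<open>K\<close>.
\<close>

lemma emeasure_update_outside:
  assumes l: "\<And>y. l y > 0" "\<And>y. l' y > 0"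
  shows "emeasure (site_measure E (override_on l l' (- K)) (override_on m m' (- K))) A =
    emeasure (site_measure E l m) A"
proof -
  have c: "countable (UNIV :: 'v set)" using graph by (intro countable_vertices)
  let ?T = "\<lambda>l. pmf_field (\<lambda>p :: 'v \<times> nat. instr_pmf E (l (fst p)) (fst p))"
  let ?C = "\<lambda>m. pmf_field (\<lambda>x :: 'v. map_pmf Active (poisson_pmf (m x)))"
  have outside: "(override_on \<eta> \<eta>' (- K), override_on \<tau> \<tau>' ((- K) \<times> UNIV)) \<in> A \<longleftrightarrow> (\<eta>, \<tau>) \<in> A"
    if "all_active \<eta>" "all_active \<eta>'" "regular_array E \<tau>" "regular_array E \<tau>'" for \<eta> \<eta>' \<tau> \<tau>'
  proof -
    have act: "all_active (override_on \<eta> \<eta>' (- K))"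
      using that by (auto simp: all_active_def override_on_def)
    show ?thesis
      unfolding mem_event_iff[OF that(1,3)] mem_event_iff[OF act regular_array_override_on[OF that(3,4)]]
      by (intro ex_cong1 conj_cong iffI refl; erule reachable_cong_prefix)
         (auto simp: stack_override_on)
  qed
  interpret T': prob_space "?T l'" by (rule prob_space_pmf_field)
  interpret C': prob_space "?C m'" by (rule prob_space_pmf_field)
  interpret T: prob_space "?T l" by (rule prob_space_pmf_field)
  have "emeasure (site_measure E (override_on l l' (- K)) (override_on m m' (- K))) A =
      (\<integral>\<^sup>+\<eta>. \<integral>\<^sup>+\<tau>. \<integral>\<^sup>+\<eta>'. \<integral>\<^sup>+\<tau>'. indicator A (\<eta>, \<tau>) \<partial>?T l' \<partial>?C m' \<partial>?T l \<partial>?C m)"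
    unfolding emeasure_site_measure_override_on
    apply (rule nn_integral_cong_AE, rule AE_mp[OF AE_all_active[OF c]], rule AE_I2, rule impI)
    apply (rule nn_integral_cong_AE, rule AE_mp[OF AE_regular_array[OF graph l(1)]], rule AE_I2, rule impI)
    apply (rule nn_integral_cong_AE, rule AE_mp[OF AE_all_active[OF c]], rule AE_I2, rule impI)
    apply (rule nn_integral_cong_AE, rule AE_mp[OF AE_regular_array[OF graph l(2)]], rule AE_I2, rule impI)
    by (simp add: indicator_def outside)
  also have "\<dots> = (\<integral>\<^sup>+\<eta>. \<integral>\<^sup>+\<tau>. indicator A (\<eta>, \<tau>) \<partial>?T l \<partial>?C m)"
    using T'.emeasure_space_1 C'.emeasure_space_1 by simp
  also have "\<dots> = emeasure (site_measure E l m) A"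
    unfolding site_measure_def using A_sets
    by (intro T.emeasure_pair_measure[symmetric]) (simp add: arw_space_def cong: sets_pair_measure_cong)
  finally show ?thesis .
qed

end

theorem theorem1p2:
  fixes E :: "'v set set"
    and A :: "('v config \<times> 'v array) set"
    and l m l' m' :: real
  assumes "infinite (UNIV :: 'v set)"
    and "undirected_graph E"
    and "connected_graph E"
    and "locally_finite E"
    and "unimodular E"
    and "relevant_event E A"
    and "l > 0" and "m > 0"
    and "(l', m') \<in> param_region l m"
  shows "measure (arw_measure E l m) A \<le> measure (arw_measure E l' m') A"
proof -
  obtain K H where A_sets: "A \<in> sets arw_space" and K: "finite K"
    and A: "A = {(\<eta>, \<tau>). \<tau> \<in> arrays E \<and> (\<forall>x\<in>K. jump_odometer K \<eta> \<tau> x \<ge> enat (H x))}"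
    using assms(6) unfolding relevant_event_def by blast
  note event = assms(1,3,4) A_sets K A
  have l': "l' > 0" using assms(7,9) by (auto simp: param_region_def)
  have swap: "override_on (\<lambda>_. a) (\<lambda>_. b) K = override_on (\<lambda>_. b) (\<lambda>_. a) (- K)" for a b :: real
    by (auto simp: override_on_def)
  have "emeasure (arw_measure E l m) A \<le> emeasure (site_measure E
      (override_on (\<lambda>_. l) (\<lambda>_. l') K) (override_on (\<lambda>_. m) (\<lambda>_. m') K)) A"
    unfolding arw_measure_eq_site_measure
    by (rule emeasure_update_sites_mono[OF event assms(7-9) l' K])
  also have "\<dots> = emeasure (arw_measure E l' m') A"
    unfolding arw_measure_eq_site_measure swap
    by (rule emeasure_update_outside[OF event]) (use l' assms(7) in auto)
  finally have le: "emeasure (arw_measure E l m) A \<le> emeasure (arw_measure E l' m') A" .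
  have "prob_space (arw_measure E l m)" for l m
    unfolding arw_measure_eq_site_measure site_measure_def
    by (intro prob_space_pair prob_space_pmf_field)
  then show ?thesis
    using le by (simp add: finite_measure.emeasure_eq_measure prob_space.finite_measure)
qed

end
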